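(* Let $n\ge 1$. Let $A_1,\dots,A_n$ be system observables, $|\psi_i\rangle,|\psi_f\rangle$ the initial and post-selected system states, and $U_1,\dots,U_{n+1}$ the unitary evolutions of the system, with $\langle\psi_f|U_{n+1}\cdots U_1|\psi_i\rangle\ne 0$. For $k=1,\dots,n$ let $\phi_k$ be an arbitrary normalized initial wavefunction of the $k$-th pointer, let $s_k$ and $r_k$ be arbitrary observables (Hermitian functions of position $q_k$ and momentum $p_k$) of the $k$-th pointer, let $A_k$ be weakly measured through the interaction Hamiltonian $g_k s_k A_k$ with small real coupling constant $g_k$, and let $r_k$ be the pointer observable measured after the coupling. Put $$\xi=2(-i)^n\left(\prod_{k=1}^n\langle r_ks_k\rangle_i-\prod_{k=1}^n\langle r_k\rangle_i\langle s_k\rangle_i\right).$$ If $n\ge 2$ then, up to total order $n$ in the $g_k$, $$\langle r_1\cdots r_n\rangle^c=g_1\cdots g_n\,\mathrm{Re}\left\{\xi\,(A_n,\dots,A_1)^c_w\right\}.$$ If $n=1$ then (writing $r=r_1$, $s=s_1$, $g=g_1$, $A=A_1$, so that $\xi=-2i(\langle rs\rangle_i-\langle r\rangle_i\langle s\rangle_i)$), up to order $1$ in $g$, $$\langle r\rangle=\langle r\rangle_i+g\,\mathrm{Re}(\xi A_w).$$ Here $\langle r_1\cdots r_n\rangle^c$ is the cumulant of the post-selected pointer expectations and $(A_n,\dots,A_1)_w^c$ is the cumulant of the sequential weak values, both as defined in the context.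
   Context: Setting and notation. The system has Hilbert space $\mathcal H$, with vectors $|\psi_i\rangle,|\psi_f\rangle\in\mathcal H$, Hermitian operators $A_1,\dots,A_n$ and unitaries $U_1,\dots,U_{n+1}$ on $\mathcal H$ ($U_k$ is the evolution between the times at which $A_{k-1}$ and $A_k$ are measured, $U_1$ is the evolution from the initial state to the first measurement and $U_{n+1}$ that from the last measurement to the final state). Each pointer $k$ is a separate quantum particle on a line with state space $L^2(\mathbb R)$, position $q_k$ and momentum $p_k$ with $[q_k,p_k]=i$ (units with $\hbar=1$). For an operator $x_k$ on pointer $k$, $\langle x_k\rangle_i:=\langle\phi_k|x_k|\phi_k\rangle$ (the subscript $i$ stands for "initial"; elsewhere $i$ is the imaginary unit). Sequential weak values. For $b=\{b_1<\dots<b_\kappa\}\subseteq\{1,\dots,n\}$ nonempty, $$(A_{b_\kappa},\dots,A_{b_1})_w:=\frac{\langle\psi_f|U_{n+1}\cdots U_{b_\kappa+1}A_{b_\kappa}U_{b_\kappa}\cdots U_{b_1+1}A_{b_1}U_{b_1}\cdots U_1|\psi_i\rangle}{\langle\psi_f|U_{n+1}\cdots U_1|\psi_i\rangle},$$ i.e. the numerator is $\langle\psi_f|U_{n+1}B_nU_n\cdots B_1U_1|\psi_i\rangle$ with $B_k=A_k$ if $k\in b$ and $B_k=1$ otherwise. For $n=1$ this is $A_w$. Pointer expectations. For each nonempty $b=\{b_1<\dots<b_\kappa\}$, $\langle r_{b_1}\cdots r_{b_\kappa}\rangle$ is evaluated in a separate experiment in which only the pointers in $b$ are coupled. After coupling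 and post-selection of the system in $|\psi_f\rangle$, the (unnormalized) state of these pointers is $$\Psi_b=\langle\psi_f|U_{n+1}\cdots U_{b_\kappa+1}e^{-ig_{b_\kappa}s_{b_\kappa}A_{b_\kappa}}U_{b_\kappa}\cdots e^{-ig_{b_1}s_{b_1}A_{b_1}}U_{b_1}\cdots U_1|\psi_i\rangle\,\phi_{b_1}\otimes\cdots\otimes\phi_{b_\kappa}$$ (partial inner product over the system), and $$\langle r_{b_1}\cdots r_{b_\kappa}\rangle:=\frac{\langle\Psi_b|r_{b_1}\cdots r_{b_\kappa}|\Psi_b\rangle}{\langle\Psi_b|\Psi_b\rangle}.$$ These are regarded as power series in the real variables $g_k$, obtained by expanding each exponential as $\sum_l (-ig_ks_kA_k)^l/l!$; all the resulting coefficients (system matrix elements involving powers of the $A_k$, and pointer moments $\langle s_k^m r_k s_k^l\rangle_i$, $\langle s_k^m s_k^l\rangle_i$) are assumed to be finite and well defined. "Up to total order $n$ in the $g_k$" means that the two sides have equal coefficients at every monomial in the $g_k$ of total degree at most $n$. Cumulants. For a family of numbers (or power series) $f(b)$ indexed by nonempty subsets $b\subseteq\{1,\dots,n\}$, the cumulant is $$\sum_{\{b_1,\dots,b_k\}}(k-1)!\,(-1)^{k-1}\prod_{j=1}^kf(b_j),$$ the sum being over all partitions of $\{1,\dots,n\}$ into nonempty disjoint subsets. $\langle r_1\cdots r_n\rangle^c$ is the cumulant of $f(b)=\langle\prod_{k\in b}r_k\rangle$, and $(A_n,\dots,A_1)^c_w$ is the cumulant of $f(b)=(A_{b_\kappa},\dots,A_{b_1})_w$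 where $b=\{b_1<\dots<b_\kappa\}$. *)

theory Defs
  imports
    "HOL-Analysis.Analysis"
    "HOL-Library.Poly_Mapping"
    "HOL-Library.Disjoint_Sets"
begin

text \<open>The inner product is conjugate-linear in its first argument (Dirac convention).\<close>

class complex_inner = real_inner +
  fixes scaleC :: "complex \<Rightarrow> 'a \<Rightarrow> 'a" (infixr "*\<^sub>C" 75)
    and cinner :: "'a \<Rightarrow> 'a \<Rightarrow> complex"
  assumes scaleC_add_right: "c *\<^sub>C (x + y) = c *\<^sub>C x + c *\<^sub>C y"
    and scaleC_add_left: "(c + d) *\<^sub>C x = c *\<^sub>C x + d *\<^sub>C x"
    and scaleC_scaleC: "c *\<^sub>C (d *\<^sub>C x) = (c * d) *\<^sub>C x"
    and scaleC_of_real: "complex_of_real t *\<^sub>C x = t *\<^sub>R x"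
    and cinner_commute: "cinner x y = cnj (cinner y x)"
    and cinner_add_right: "cinner x (y + z) = cinner x y + cinner x z"
    and cinner_scaleC_right: "cinner x (c *\<^sub>C y) = c * cinner x y"
    and Re_cinner: "Re (cinner x y) = inner x y"

class chilbert_space = complex_inner + complete_space

definition square_integrable :: "(real \<Rightarrow> complex) \<Rightarrow> bool" where
  "square_integrable f \<longleftrightarrow>
     f \<in> borel_measurable lborel \<and> integrable lborel (\<lambda>x. (cmod (f x))\<^sup>2)"

lemma square_integrable_zero: "square_integrable (\<lambda>x. 0)"
  by (simp add: square_integrable_def)

lemma square_integrable_add:
  assumes "square_integrable f" "square_integrable g"
  shows "square_integrable (\<lambda>x. f x + g x)"
proof -
  have m: "f \<in> borel_measurable lborel" "g \<in> borel_measurable lborel"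
    using assms by (auto simp: square_integrable_def)
  have "integrable lborel (\<lambda>x. 2 * (cmod (f x))\<^sup>2 + 2 * (cmod (g x))\<^sup>2)"
    using assms by (auto simp: square_integrable_def)
  then have "integrable lborel (\<lambda>x. (cmod (f x + g x))\<^sup>2)"
  proof (rule Bochner_Integration.integrable_bound)
    show "(\<lambda>x. (cmod (f x + g x))\<^sup>2) \<in> borel_measurable lborel"
      using m by measurable
    have "(cmod (f x + g x))\<^sup>2 \<le> 2 * (cmod (f x))\<^sup>2 + 2 * (cmod (g x))\<^sup>2" for x
    proof -
      have "(cmod (f x + g x))\<^sup>2 \<le> (cmod (f x) + cmod (g x))\<^sup>2"
        by (intro power_mono norm_triangle_ineq norm_ge_zero)
      also have "\<dots> \<le> 2 * (cmod (f x))\<^sup>2 + 2 * (cmod (g x))\<^sup>2"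
        using zero_le_power2[of "cmod (f x) - cmod (g x)"]
        by (simp add: power2_eq_square algebra_simps)
      finally show ?thesis .
    qed
    then show "AE x in lborel. norm ((cmod (f x + g x))\<^sup>2)
        \<le> norm (2 * (cmod (f x))\<^sup>2 + 2 * (cmod (g x))\<^sup>2)"
      by simp
  qed
  then show ?thesis using m by (auto simp: square_integrable_def)
qed

lemma square_integrable_scale:
  assumes "square_integrable f"
  shows "square_integrable (\<lambda>x. c * f x)"
  using assms by (auto simp: square_integrable_def norm_mult power_mult_distrib)

lemma square_integrable_product:
  assumes "square_integrable f" "square_integrable g"
  shows "integrable lborel (\<lambda>x. cnj (f x) * g x)"
proof -
  have m: "f \<in> borel_measurable lborel" "g \<in> borel_measurable lborel"
    using assms by (auto simp: square_integrable_def)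
  have "integrable lborel (\<lambda>x. (cmod (f x))\<^sup>2 + (cmod (g x))\<^sup>2)"
    using assms by (auto simp: square_integrable_def)
  then show ?thesis
  proof (rule Bochner_Integration.integrable_bound)
    have "(\<lambda>x. cnj (f x)) \<in> borel_measurable lborel"
      by (rule borel_measurable_continuous_on[OF _ m(1)]) (intro continuous_intros)
    then show "(\<lambda>x. cnj (f x) * g x) \<in> borel_measurable lborel"
      using m by measurable
    have "cmod (f x) * cmod (g x) \<le> (cmod (f x))\<^sup>2 + (cmod (g x))\<^sup>2" for x
    proof -
      have "0 \<le> (cmod (f x) - cmod (g x))\<^sup>2" "0 \<le> cmod (f x) * cmod (g x)" by simp_all
      then show ?thesis unfolding power2_diff by linarith
    qed
    then show "AE x in lborel. norm (cnj (f x) * g x)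
        \<le> norm ((cmod (f x))\<^sup>2 + (cmod (g x))\<^sup>2)"
      by (simp add: norm_mult)
  qed
qed

text \<open>Borel representatives suffice, as every Lebesgue measurable function agrees almost everywhere
  with a Borel measurable one.\<close>

quotient_type L2 = "real \<Rightarrow> complex" / partial:
  "\<lambda>f g. square_integrable f \<and> square_integrable g \<and> (AE x in lborel. f x = g x)"
proof (rule part_equivpI)
  show "\<exists>f. square_integrable f \<and> square_integrable f \<and> (AE x in lborel. f x = f x)"
    using square_integrable_zero by auto
  show "symp (\<lambda>f g. square_integrable f \<and> square_integrable g \<and> (AE x in lborel. f x = g x))"
    by (auto simp: symp_def elim: AE_mp)
  show "transp (\<lambda>f g. square_integrable f \<and> square_integrable g \<and> (AE x in lborel. f x = g x))"
    by (auto simp: transp_def)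
qed

lemma square_integrable_rep: "square_integrable (rep_L2 u)"
  using Quotient_rep_reflp[OF Quotient_L2, of u] by simp

lemma L2_eqI: "(AE x in lborel. rep_L2 u x = rep_L2 v x) \<Longrightarrow> u = v"
  using Quotient_rel_rep[OF Quotient_L2, of u v] square_integrable_rep by blast

lemma rep_abs_L2:
  assumes "square_integrable f"
  shows "AE x in lborel. rep_L2 (abs_L2 f) x = f x"
  using Quotient_rep_abs[OF Quotient_L2, of f] assms by simp

instantiation L2 :: complex_inner
begin

definition "0 = abs_L2 (\<lambda>x. 0)"
definition "u + v = abs_L2 (\<lambda>x. rep_L2 u x + rep_L2 v x)"
definition "scaleC c u = abs_L2 (\<lambda>x. c * rep_L2 u x)"
definition "scaleR t (u :: L2) = scaleC (complex_of_real t) u"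
definition "- (u :: L2) = scaleC (-1) u"
definition "u - (v :: L2) = u + (- v)"
definition "cinner u v = (\<integral>x. cnj (rep_L2 u x) * rep_L2 v x \<partial>lborel)"
definition "inner (u :: L2) v = Re (cinner u v)"
definition "norm (u :: L2) = sqrt (inner u u)"
definition "sgn (u :: L2) = inverse (norm u) *\<^sub>R u"
definition "dist u (v :: L2) = norm (u - v)"
definition "uniformity = (INF e\<in>{0 <..}. principal {(u :: L2, v). dist u v < e})"
definition "open (S :: L2 set) = (\<forall>u\<in>S. \<forall>\<^sub>F (u', v) in uniformity. u' = u \<longrightarrow> v \<in> S)"

lemma rep_zero_L2: "AE x in lborel. rep_L2 0 x = 0"
  unfolding zero_L2_def by (rule rep_abs_L2[OF square_integrable_zero])

lemma rep_plus_L2: "AE x in lborel. rep_L2 (u + v) x = rep_L2 u x + rep_L2 v x"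
  unfolding plus_L2_def by (intro rep_abs_L2 square_integrable_add square_integrable_rep)

lemma rep_scaleC_L2: "AE x in lborel. rep_L2 (scaleC c u) x = c * rep_L2 u x"
  unfolding scaleC_L2_def by (intro rep_abs_L2 square_integrable_scale square_integrable_rep)

lemma cinner_self_L2: "cinner u (u :: L2) = complex_of_real (\<integral>x. (cmod (rep_L2 u x))\<^sup>2 \<partial>lborel)"
proof -
  have "cnj z * z = complex_of_real ((cmod z)\<^sup>2)" for z
    by (metis complex_norm_square mult.commute)
  then have "cinner u u = (\<integral>x. complex_of_real ((cmod (rep_L2 u x))\<^sup>2) \<partial>lborel)"
    unfolding cinner_L2_def by presburger
  then show ?thesis by (simp only: integral_complex_of_real)
qed

instance
proof
  fix u v w :: L2 and c d :: complex and s t :: real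
  show add_assoc: "u + v + w = u + (v + w)" for u v w :: L2
    by (rule L2_eqI)
      (use rep_plus_L2[of "u + v" w] rep_plus_L2[of u v] rep_plus_L2[of u "v + w"]
        rep_plus_L2[of v w] in eventually_elim, simp add: algebra_simps)
  show add_comm: "u + v = v + u"
    by (simp add: plus_L2_def add.commute)
  show "0 + u = u"
    by (rule L2_eqI) (use rep_plus_L2[of 0 u] rep_zero_L2 in eventually_elim, simp)
  show "- u + u = 0"
    unfolding uminus_L2_def
    by (rule L2_eqI)
      (use rep_plus_L2[of "scaleC (- 1) u" u] rep_scaleC_L2[of "-1" u] rep_zero_L2
        in eventually_elim, simp)
  show "u - v = u + - v" by (rule minus_L2_def)
  show C1: "c *\<^sub>C (u + v) = c *\<^sub>C u + c *\<^sub>C v" for c and u v :: L2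
    by (rule L2_eqI)
      (use rep_scaleC_L2[of c "u + v"] rep_plus_L2[of u v] rep_plus_L2[of "c *\<^sub>C u" "c *\<^sub>C v"]
        rep_scaleC_L2[of c u] rep_scaleC_L2[of c v] in eventually_elim, simp add: algebra_simps)
  show C2: "(c + d) *\<^sub>C u = c *\<^sub>C u + d *\<^sub>C u" for c d and u :: L2
    by (rule L2_eqI)
      (use rep_scaleC_L2[of "c + d" u] rep_plus_L2[of "c *\<^sub>C u" "d *\<^sub>C u"]
        rep_scaleC_L2[of c u] rep_scaleC_L2[of d u] in eventually_elim, simp add: algebra_simps)
  show C3: "c *\<^sub>C d *\<^sub>C u = (c * d) *\<^sub>C u" for c d and u :: L2
    by (rule L2_eqI)
      (use rep_scaleC_L2[of c "d *\<^sub>C u"] rep_scaleC_L2[of d u] rep_scaleC_L2[of "c * d" u]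
        in eventually_elim, simp add: algebra_simps)
  show "complex_of_real t *\<^sub>C u = t *\<^sub>R u" by (simp add: scaleR_L2_def)
  show "t *\<^sub>R (u + v) = t *\<^sub>R u + t *\<^sub>R v" by (simp add: scaleR_L2_def C1)
  show "(s + t) *\<^sub>R u = s *\<^sub>R u + t *\<^sub>R u" by (simp add: scaleR_L2_def C2)
  show "s *\<^sub>R t *\<^sub>R u = (s * t) *\<^sub>R u" by (simp add: scaleR_L2_def C3)
  show "1 *\<^sub>R u = u"
    unfolding scaleR_L2_def
    by (rule L2_eqI) (use rep_scaleC_L2[of 1 u] in eventually_elim, simp)
  show "sgn u = inverse (norm u) *\<^sub>R u" by (rule sgn_L2_def)
  show "dist u v = norm (u - v)" by (rule dist_L2_def)
  show "uniformity = (INF e\<in>{0 <..}. principal {(u :: L2, v). dist u v < e})"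
    by (rule uniformity_L2_def)
  show "open S = (\<forall>u\<in>S. \<forall>\<^sub>F (u', v) in uniformity. u' = u \<longrightarrow> v \<in> S)" for S :: "L2 set"
    by (rule open_L2_def)
  show I1: "cinner u v = cnj (cinner v u)" for u v :: L2
  proof -
    have "cnj (\<integral>x. cnj (rep_L2 v x) * rep_L2 u x \<partial>lborel)
        = (\<integral>x. cnj (cnj (rep_L2 v x) * rep_L2 u x) \<partial>lborel)"
      by (rule Bochner_Integration.integral_cnj[symmetric])
    then show ?thesis by (simp add: cinner_L2_def mult.commute)
  qed
  have int: "integrable lborel (\<lambda>x. cnj (rep_L2 u x) * rep_L2 v x)" for u v
    by (intro square_integrable_product square_integrable_rep)
  have meas: "rep_L2 u \<in> borel_measurable lborel" for u
    using square_integrable_rep[of u] by (simp add: square_integrable_def)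
  show I2: "cinner u (v + w) = cinner u v + cinner u w" for u v w :: L2
  proof -
    have "cinner u (v + w) = (\<integral>x. cnj (rep_L2 u x) * rep_L2 v x + cnj (rep_L2 u x) * rep_L2 w x \<partial>lborel)"
      unfolding cinner_L2_def
    proof (rule integral_cong_AE)
      show "AE x in lborel. cnj (rep_L2 u x) * rep_L2 (v + w) x =
          cnj (rep_L2 u x) * rep_L2 v x + cnj (rep_L2 u x) * rep_L2 w x"
        using rep_plus_L2[of v w] by eventually_elim (simp add: algebra_simps)
    qed (use int in \<open>auto intro!: borel_measurable_integrable\<close>)
    also have "\<dots> = cinner u v + cinner u w"
      unfolding cinner_L2_def by (rule Bochner_Integration.integral_add[OF int int])
    finally show ?thesis .
  qed
  show I3: "cinner u (c *\<^sub>C v) = c * cinner u v" for c and u v :: L2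
  proof -
    have "cinner u (c *\<^sub>C v) = (\<integral>x. c * (cnj (rep_L2 u x) * rep_L2 v x) \<partial>lborel)"
      unfolding cinner_L2_def
    proof (rule integral_cong_AE)
      show "AE x in lborel. cnj (rep_L2 u x) * rep_L2 (c *\<^sub>C v) x =
          c * (cnj (rep_L2 u x) * rep_L2 v x)"
        using rep_scaleC_L2[of c v] by eventually_elim (simp add: algebra_simps)
    qed (use int in \<open>auto intro!: borel_measurable_integrable\<close>)
    then show ?thesis unfolding cinner_L2_def by simp
  qed
  show "Re (cinner u v) = inner u v" by (simp add: inner_L2_def)
  show "inner u v = inner v u"
    unfolding inner_L2_def by (subst I1) simp
  show "inner (u + v) w = inner u w + inner v w"
    unfolding inner_L2_def by (subst (1 2 3) I1) (simp add: I2)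
  show "inner (t *\<^sub>R u) v = t * inner u v"
    unfolding inner_L2_def scaleR_L2_def by (subst (1 2) I1) (simp add: I3)
  show "0 \<le> inner u u"
    unfolding inner_L2_def cinner_self_L2 by simp
  show "norm u = sqrt (inner u u)" by (rule norm_L2_def)
  show "(inner u u = 0) = (u = 0)"
  proof
    assume "inner u u = 0"
    then have "(\<integral>x. (cmod (rep_L2 u x))\<^sup>2 \<partial>lborel) = 0"
      unfolding inner_L2_def cinner_self_L2 by simp
    then have ae: "AE x in lborel. (cmod (rep_L2 u x))\<^sup>2 = 0"
      using square_integrable_rep[of u]
      by (subst (asm) integral_nonneg_eq_0_iff_AE) (auto simp: square_integrable_def)
    then show "u = 0"
      by (intro L2_eqI) (use ae rep_zero_L2 in eventually_elim, simp)
  next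
    assume u: "u = 0"
    have "(\<integral>x. (cmod (rep_L2 0 x))\<^sup>2 \<partial>lborel) = (\<integral>x. 0 \<partial>(lborel :: real measure))"
      by (rule integral_cong_AE)
        (use meas[of 0] rep_zero_L2 in \<open>auto elim: eventually_mono\<close>)
    then show "inner u u = 0"
      unfolding u inner_L2_def cinner_self_L2 by simp
  qed
qed

end

text \<open>Observables may be unbounded, so an operator carries its domain. Pointer observables range over
  all densely defined symmetric operators on \<open>L\<^sup>2(\<real>)\<close>; Hermitian functions of the position
  \<open>q\<close> and the momentum \<open>p\<close> are among these.\<close>

datatype 'a operator = Operator (op_dom: "'a set") (op_act: "'a \<Rightarrow> 'a")

definition op_id :: "'a operator" where
  "op_id = Operator UNIV (\<lambda>x. x)"

definition op_comp :: "'a operator \<Rightarrow> 'a operator \<Rightarrow> 'a operator" where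
  "op_comp S T =
     Operator {x \<in> op_dom T. op_act T x \<in> op_dom S} (\<lambda>x. op_act S (op_act T x))"

primrec op_pow :: "'a operator \<Rightarrow> nat \<Rightarrow> 'a operator" where
  "op_pow T 0 = op_id"
| "op_pow T (Suc l) = op_comp T (op_pow T l)"

definition hermitian :: "'a::complex_inner operator \<Rightarrow> bool" where
  "hermitian T \<longleftrightarrow>
     closure (op_dom T) = UNIV \<and>
     (\<forall>x\<in>op_dom T. \<forall>y\<in>op_dom T.
        x + y \<in> op_dom T \<and> op_act T (x + y) = op_act T x + op_act T y) \<and>
     (\<forall>c. \<forall>x\<in>op_dom T. c *\<^sub>C x \<in> op_dom T \<and> op_act T (c *\<^sub>C x) = c *\<^sub>C op_act T x) \<and>
     (\<forall>x\<in>op_dom T. \<forall>y\<in>op_dom T. cinner (op_act T x) y = cinner x (op_act T y))"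

definition unitary :: "('a::complex_inner \<Rightarrow> 'a) \<Rightarrow> bool" where
  "unitary U \<longleftrightarrow>
     (\<forall>x y. U (x + y) = U x + U y) \<and> (\<forall>c x. U (c *\<^sub>C x) = c *\<^sub>C U x) \<and>
     surj U \<and> (\<forall>x y. cinner (U x) (U y) = cinner x y)"

definition expval :: "'a::complex_inner \<Rightarrow> 'a operator \<Rightarrow> complex" where
  "expval \<phi> T = cinner \<phi> (op_act T \<phi>)"

text \<open>A monomial is given by its finitely supported exponent vector; variable \<open>k\<close> is \<open>g\<^sub>k\<close>.\<close>

type_synonym monomial = "nat \<Rightarrow>\<^sub>0 nat"

definition total_degree :: "monomial \<Rightarrow> nat" where
  "total_degree e = (\<Sum>k\<in>Poly_Mapping.keys e. Poly_Mapping.lookup e k)"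

definition splittings :: "monomial \<Rightarrow> (monomial \<times> monomial) set" where
  "splittings e = {(a, c). a + c = e}"

lemma total_degree_add: "total_degree (a + c) = total_degree a + total_degree c"
  unfolding total_degree_def by (rule setsum_keys_plus_distrib) simp_all

lemma total_degree_eq_0_iff: "total_degree e = 0 \<longleftrightarrow> e = 0"
  by (auto simp: total_degree_def in_keys_iff poly_mapping_eq_iff fun_eq_iff)

lemma finite_splittings: "finite (splittings e)"
proof -
  let ?F = "{f. \<forall>k. (k \<in> Poly_Mapping.keys e \<longrightarrow> f k \<in> {..total_degree e}) \<and>
      (k \<notin> Poly_Mapping.keys e \<longrightarrow> f k = 0)}"
  let ?B = "{a :: monomial. Poly_Mapping.lookup a \<in> ?F}"
  have "finite ?F"
    by (rule finite_set_of_finite_funs) simp_all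
  then have B: "finite ?B"
    using finite_vimageI[of ?F Poly_Mapping.lookup] by (simp add: inj_on_def vimage_def)
  have le: "Poly_Mapping.lookup e k \<le> total_degree e" if "k \<in> Poly_Mapping.keys e" for k
    unfolding total_degree_def using that by (intro member_le_sum) auto
  have "a \<in> ?B \<and> c \<in> ?B" if "a + c = e" for a c
  proof -
    have *: "Poly_Mapping.lookup e k = Poly_Mapping.lookup a k + Poly_Mapping.lookup c k" for k
      using that by (auto simp: lookup_add)
    show ?thesis
    proof (intro conjI CollectI allI impI)
      fix k
      assume "k \<in> Poly_Mapping.keys e"
      from le[OF this]
      show "Poly_Mapping.lookup a k \<in> {..total_degree e}" "Poly_Mapping.lookup c k \<in> {..total_degree e}"
        by (simp_all add: *)
    next
      fix k
      assume "k \<notin> Poly_Mapping.keys e"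
      then show "Poly_Mapping.lookup a k = 0" "Poly_Mapping.lookup c k = 0"
        by (simp_all add: in_keys_iff *)
    qed
  qed
  then have "splittings e \<subseteq> ?B \<times> ?B"
    unfolding splittings_def by blast
  then show ?thesis using B by (meson finite_SigmaI finite_subset)
qed

typedef mpseries = "UNIV :: (monomial \<Rightarrow> complex) set"
  morphisms mps_coeff Abs_mpseries ..

setup_lifting type_definition_mpseries

lemma mps_eqI: "(\<And>e. mps_coeff f e = mps_coeff g e) \<Longrightarrow> f = g"
  by (simp add: mps_coeff_inject[symmetric] fun_eq_iff)

instantiation mpseries :: comm_ring_1
begin

lift_definition zero_mpseries :: mpseries is "\<lambda>e. 0" .
lift_definition one_mpseries :: mpseries is "\<lambda>e. if e = 0 then 1 else 0" .
lift_definition plus_mpseries :: "mpseries \<Rightarrow> mpseries \<Rightarrow> mpseries" is "\<lambda>f g e. f e + g e" .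
lift_definition minus_mpseries :: "mpseries \<Rightarrow> mpseries \<Rightarrow> mpseries" is "\<lambda>f g e. f e - g e" .
lift_definition uminus_mpseries :: "mpseries \<Rightarrow> mpseries" is "\<lambda>f e. - f e" .
lift_definition times_mpseries :: "mpseries \<Rightarrow> mpseries \<Rightarrow> mpseries" is
  "\<lambda>f g e. \<Sum>(a, c)\<in>splittings e. f a * g c" .

instance
proof
  fix f g h :: mpseries
  show "f * g * h = f * (g * h)"
  proof (rule mps_eqI)
    fix e
    let ?t = "\<lambda>a b c. mps_coeff f a * mps_coeff g b * mps_coeff h c"
    have "mps_coeff (f * g * h) e =
        (\<Sum>p\<in>splittings e. \<Sum>q\<in>splittings (fst p). ?t (fst q) (snd q) (snd p))"
      by (simp add: times_mpseries.rep_eq sum_distrib_right case_prod_beta)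
    also have "\<dots> = (\<Sum>(p, q)\<in>(SIGMA p:splittings e. splittings (fst p)). ?t (fst q) (snd q) (snd p))"
      by (rule sum.Sigma) (auto simp: finite_splittings)
    also have "\<dots> = (\<Sum>(p, q)\<in>(SIGMA p:splittings e. splittings (snd p)). ?t (fst p) (fst q) (snd q))"
      by (rule sum.reindex_bij_witness[where
            i = "\<lambda>((a, _), (b, c)). ((a + b, c), (a, b))" and
            j = "\<lambda>((_, c), (a, b)). ((a, b + c), (b, c))"])
        (auto simp: splittings_def add.assoc)
    also have "\<dots> = (\<Sum>p\<in>splittings e. \<Sum>q\<in>splittings (snd p). ?t (fst p) (fst q) (snd q))"
      by (rule sum.Sigma[symmetric]) (auto simp: finite_splittings)
    also have "\<dots> = mps_coeff (f * (g * h)) e"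
      by (simp add: times_mpseries.rep_eq sum_distrib_left case_prod_beta mult.assoc)
    finally show "mps_coeff (f * g * h) e = mps_coeff (f * (g * h)) e" .
  qed
  show "f * g = g * f"
    by (rule mps_eqI, unfold times_mpseries.rep_eq,
        rule sum.reindex_bij_witness[where i = prod.swap and j = prod.swap])
      (auto simp: splittings_def add.commute mult.commute)
  show "1 * f = f"
  proof (rule mps_eqI)
    fix e
    have "mps_coeff (1 * f) e = (\<Sum>p\<in>splittings e. if p = (0, e) then mps_coeff f e else 0)"
      unfolding times_mpseries.rep_eq one_mpseries.rep_eq
      by (rule sum.cong) (auto simp: splittings_def split: if_splits)
    also have "\<dots> = mps_coeff f e"
      by (subst sum.delta[OF finite_splittings]) (simp add: splittings_def)
    finally show "mps_coeff (1 * f) e = mps_coeff f e" .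
  qed
  show "(f + g) * h = f * h + g * h"
    by (rule mps_eqI)
      (simp add: times_mpseries.rep_eq plus_mpseries.rep_eq case_prod_beta sum.distrib distrib_right)
  show "(0 :: mpseries) \<noteq> 1"
    by transfer (auto simp: fun_eq_iff)
qed (rule mps_eqI, simp add: plus_mpseries.rep_eq minus_mpseries.rep_eq uminus_mpseries.rep_eq
      zero_mpseries.rep_eq)+

end

lift_definition mps_const :: "complex \<Rightarrow> mpseries" is "\<lambda>z e. if e = 0 then z else 0" .

lift_definition mps_var :: "nat \<Rightarrow> mpseries" is
  "\<lambda>k e. if e = Poly_Mapping.single k 1 then 1 else 0" .

text \<open>Quotients by series with nonzero constant term, by comparison of coefficients in \<open>q * g = f\<close>.\<close>

function mps_div_coeff :: "mpseries \<Rightarrow> mpseries \<Rightarrow> monomial \<Rightarrow> complex" where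
  "mps_div_coeff f g e =
     (mps_coeff f e - (\<Sum>(a, c) \<in> splittings e - {(e, 0)}. mps_div_coeff f g a * mps_coeff g c))
       / mps_coeff g 0"
  by auto
termination
proof (relation "Wellfounded.measure (\<lambda>(f, g, e). total_degree e)")
  fix f g :: mpseries and e p a c
  assume "p \<in> splittings e - {(e, 0)}" "(a, c) = p"
  then have "a + c = e" "c \<noteq> 0" by (auto simp: splittings_def)
  then show "((f, g, a), f, g, e) \<in> Wellfounded.measure (\<lambda>(f, g, e). total_degree e)"
    using total_degree_eq_0_iff[of c] by (auto simp: total_degree_add)
qed simp

declare mps_div_coeff.simps [simp del]

definition mps_div :: "mpseries \<Rightarrow> mpseries \<Rightarrow> mpseries" where
  "mps_div f g = Abs_mpseries (mps_div_coeff f g)"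

lemma mps_div_mult:
  assumes "mps_coeff g 0 \<noteq> 0"
  shows "mps_div f g * g = f"
proof (rule mps_eqI)
  fix e
  have "mps_coeff (mps_div f g * g) e =
      mps_div_coeff f g e * mps_coeff g 0
      + (\<Sum>(a, c) \<in> splittings e - {(e, 0)}. mps_div_coeff f g a * mps_coeff g c)"
    unfolding times_mpseries.rep_eq mps_div_def Abs_mpseries_inverse[OF UNIV_I]
    by (subst sum.remove[OF finite_splittings, of "(e, 0)"]) (auto simp: splittings_def)
  also have "\<dots> = mps_coeff f e"
    using assms by (subst mps_div_coeff.simps) simp
  finally show "mps_coeff (mps_div f g * g) e = mps_coeff f e" .
qed

definition eq_up_to_degree :: "nat \<Rightarrow> mpseries \<Rightarrow> mpseries \<Rightarrow> bool" where
  "eq_up_to_degree N f g \<longleftrightarrow> (\<forall>e. total_degree e \<le> N \<longrightarrow> mps_coeff f e = mps_coeff g e)"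

definition cumulant :: "nat \<Rightarrow> (nat set \<Rightarrow> 'a::comm_ring_1) \<Rightarrow> 'a" where
  "cumulant n f =
     (\<Sum>P | partition_on {1..n} P. of_nat (fact (card P - 1)) * (-1) ^ (card P - 1) * (\<Prod>b\<in>P. f b))"

text \<open>\<open>evolve U B \<psi> k\<close> is \<open>B\<^sub>k U\<^sub>k \<dots> B\<^sub>1 U\<^sub>1 \<psi>\<close>.\<close>

primrec evolve :: "(nat \<Rightarrow> 'a \<Rightarrow> 'a) \<Rightarrow> (nat \<Rightarrow> 'a operator) \<Rightarrow> 'a \<Rightarrow> nat \<Rightarrow> 'a" where
  "evolve U B \<psi> 0 = \<psi>"
| "evolve U B \<psi> (Suc k) = op_act (B (Suc k)) (U (Suc k) (evolve U B \<psi> k))"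

definition amplitude ::
  "nat \<Rightarrow> (nat \<Rightarrow> 'a \<Rightarrow> 'a) \<Rightarrow> 'a \<Rightarrow> 'a \<Rightarrow> (nat \<Rightarrow> 'a::complex_inner operator) \<Rightarrow> complex" where
  "amplitude n U \<psi>i \<psi>f B = cinner \<psi>f (U (Suc n) (evolve U B \<psi>i n))"

definition weak_value ::
  "nat \<Rightarrow> (nat \<Rightarrow> 'a \<Rightarrow> 'a) \<Rightarrow> 'a \<Rightarrow> 'a \<Rightarrow> (nat \<Rightarrow> 'a::complex_inner operator)
     \<Rightarrow> nat set \<Rightarrow> complex" where
  "weak_value n U \<psi>i \<psi>f A b =
     amplitude n U \<psi>i \<psi>f (\<lambda>k. if k \<in> b then A k else op_id) / amplitude n U \<psi>i \<psi>f (\<lambda>k. op_id)"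

text \<open>Joint wavefunctions of the pointers in \<open>b\<close> are functions of the positions \<open>x\<^sub>k\<close>,
  \<open>k \<in> b\<close>, i.e. elements of \<open>L\<^sup>2(\<real>\<^sup>b)\<close>, with product Lebesgue measure.\<close>

definition tensor :: "nat set \<Rightarrow> (nat \<Rightarrow> L2) \<Rightarrow> (nat \<Rightarrow> real) \<Rightarrow> complex" where
  "tensor b v = (\<lambda>x. \<Prod>k\<in>b. rep_L2 (v k) (x k))"

definition joint_cinner ::
  "nat set \<Rightarrow> ((nat \<Rightarrow> real) \<Rightarrow> complex) \<Rightarrow> ((nat \<Rightarrow> real) \<Rightarrow> complex) \<Rightarrow> complex" where
  "joint_cinner b \<Psi> \<Phi> = (\<integral>x. cnj (\<Psi> x) * \<Phi> x \<partial>(Pi\<^sub>M b (\<lambda>_. lborel)))"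

text \<open>\<open>pointer_state n U \<psi>i \<psi>f A \<phi> s R b\<close> is the power series, with coefficients in \<open>L\<^sup>2(\<real>\<^sup>b)\<close>,
  of \<open>\<Otimes>\<^sub>k\<^sub>\<in>\<^sub>b R\<^sub>k\<close> applied to the post-selected pointer state \<open>\<Psi>\<^sub>b\<close>, where each
  \<open>exp (- i g\<^sub>k s\<^sub>k A\<^sub>k)\<close> is expanded as \<open>\<Sum>\<^sub>l (- i g\<^sub>k)\<^sup>l / l! s\<^sub>k\<^sup>l A\<^sub>k\<^sup>l\<close>.
  With \<open>R\<^sub>k = 1\<close> this is \<open>\<Psi>\<^sub>b\<close> itself.\<close>

definition pointer_state ::
  "nat \<Rightarrow> (nat \<Rightarrow> 'a \<Rightarrow> 'a) \<Rightarrow> 'a \<Rightarrow> 'a \<Rightarrow> (nat \<Rightarrow> 'a::complex_inner operator)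
     \<Rightarrow> (nat \<Rightarrow> L2) \<Rightarrow> (nat \<Rightarrow> L2 operator) \<Rightarrow> (nat \<Rightarrow> L2 operator) \<Rightarrow> nat set
     \<Rightarrow> monomial \<Rightarrow> (nat \<Rightarrow> real) \<Rightarrow> complex" where
  "pointer_state n U \<psi>i \<psi>f A \<phi> s R b l =
     (if Poly_Mapping.keys l \<subseteq> b then
        (\<lambda>x. (\<Prod>k\<in>b. (- \<i>) ^ Poly_Mapping.lookup l k / fact (Poly_Mapping.lookup l k)) *
             amplitude n U \<psi>i \<psi>f (\<lambda>k. op_pow (A k) (Poly_Mapping.lookup l k)) *
             tensor b (\<lambda>k. op_act (op_comp (R k) (op_pow (s k) (Poly_Mapping.lookup l k))) (\<phi> k)) x)
      else (\<lambda>x. 0))"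

text \<open>The inner product of two power series with coefficients in \<open>L\<^sup>2(\<real>\<^sup>b)\<close>; the variables
  \<open>g\<^sub>k\<close> are real, hence unaffected by conjugation.\<close>

definition series_cinner ::
  "nat set \<Rightarrow> (monomial \<Rightarrow> (nat \<Rightarrow> real) \<Rightarrow> complex) \<Rightarrow> (monomial \<Rightarrow> (nat \<Rightarrow> real) \<Rightarrow> complex)
     \<Rightarrow> mpseries" where
  "series_cinner b \<Psi> \<Phi> =
     Abs_mpseries (\<lambda>e. \<Sum>(m, l)\<in>splittings e. joint_cinner b (\<Psi> m) (\<Phi> l))"

definition pointer_expectation ::
  "nat \<Rightarrow> (nat \<Rightarrow> 'a \<Rightarrow> 'a) \<Rightarrow> 'a \<Rightarrow> 'a \<Rightarrow> (nat \<Rightarrow> 'a::complex_inner operator)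
     \<Rightarrow> (nat \<Rightarrow> L2) \<Rightarrow> (nat \<Rightarrow> L2 operator) \<Rightarrow> (nat \<Rightarrow> L2 operator) \<Rightarrow> nat set \<Rightarrow> mpseries" where
  "pointer_expectation n U \<psi>i \<psi>f A \<phi> s r b =
     (let \<Psi> = pointer_state n U \<psi>i \<psi>f A \<phi> s (\<lambda>_. op_id) b;
          r\<Psi> = pointer_state n U \<psi>i \<psi>f A \<phi> s r b
      in mps_div (series_cinner b \<Psi> r\<Psi>) (series_cinner b \<Psi> \<Psi>))"

end

theory Submission
  imports Defs
begin

text \<open>In the algebra of set functions under subset convolution, the cumulant is the logarithm, hence
  additive. A monomial of degree at most \<open>n\<close> other than \<open>g\<^sub>1 \<cdots> g\<^sub>n\<close> omits
  some \<open>g\<^sub>k\<close>; at \<open>g\<^sub>k = 0\<close> pointer \<open>k\<close> is independent of the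
  others and the cumulant vanishes. The coefficient of \<open>g\<^sub>1 \<cdots> g\<^sub>n\<close> is the cumulant of
  the coefficients of \<open>\<Prod>\<^sub>k\<^sub>\<in>\<^sub>b g\<^sub>k\<close> in the expectations for \<open>b\<close>. As set functions these are
  \<open>cnj x * x * (cnj y * y)\<^sup>-\<^sup>1\<close>, where \<open>x b\<close> and \<open>y b\<close> are the weak value for
  \<open>b\<close> times \<open>\<Prod>\<^sub>k\<^sub>\<in>\<^sub>b -\<i> \<langle>r\<^sub>k s\<^sub>k\<rangle>\<close> and
  \<open>\<Prod>\<^sub>k\<^sub>\<in>\<^sub>b -\<i> \<langle>r\<^sub>k\<rangle> \<langle>s\<^sub>k\<rangle>\<close>, so the logarithm is twice the real part
  of the difference of the cumulants of \<open>x\<close> and \<open>y\<close>.\<close>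

subsection \<open>Cumulants and subset convolution\<close>

text \<open>Multiplication of polynomials \<Sum> f(S) t^S in commuting variables with t_k^2 =
  0.\<close>

definition subset_conv :: "('a set \<Rightarrow> 'b::comm_ring_1) \<Rightarrow> ('a set \<Rightarrow> 'b) \<Rightarrow> 'a set \<Rightarrow> 'b" where
  "subset_conv f g S = (\<Sum>T\<in>Pow S. f T * g (S - T))"

lemma subset_conv_commute: "subset_conv f g = subset_conv g f"
proof
  fix S
  show "subset_conv f g S = subset_conv g f S"
    unfolding subset_conv_def
    by (rule sum.reindex_bij_witness[where i = "\<lambda>T. S - T" and j = "\<lambda>T. S - T"])
      (auto simp: double_diff mult.commute)
qed

lemma subset_conv_assoc:
  "subset_conv (subset_conv f g) h = subset_conv f (subset_conv g h)"
proof
  fix S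
  show "subset_conv (subset_conv f g) h S = subset_conv f (subset_conv g h) S"
  proof (cases "finite S")
    \<comment> \<open>For infinite \<open>S\<close> both sides are sums over the infinite set
      \<open>Pow S\<close>, which default to 0.\<close>
    case False
    then show ?thesis by (simp add: subset_conv_def)
  next
    case True
    have diff: "S - V - (T - V) = S - T" if "V \<subseteq> T" for V T
      using that by blast
    have "subset_conv (subset_conv f g) h S
        = (\<Sum>(T, V)\<in>(SIGMA T:Pow S. Pow T). f V * g (T - V) * h (S - T))"
      using True finite_subset
      by (auto simp: subset_conv_def sum_distrib_right intro!: sum.Sigma)
    \<comment> \<open>Both index sets describe the ordered splittings of \<open>S\<close> into three
      parts.\<close>
    also have "\<dots> = (\<Sum>(V, T)\<in>(SIGMA V:Pow S. Pow (S - V)). f V * (g T * h (S - V - T)))"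
      by (rule sum.reindex_bij_witness[where i = "\<lambda>(V, T). (V \<union> T, V)" and j = "\<lambda>(T, V). (V, T - V)"])
        (auto simp: Un_absorb1 mult.assoc diff)
    also have "\<dots> = subset_conv f (subset_conv g h) S"
      using True by (auto simp: subset_conv_def sum_distrib_left intro!: sum.Sigma[symmetric])
    finally show ?thesis .
  qed
qed

lemma subset_conv_cong:
  assumes "\<And>T. T \<subseteq> S \<Longrightarrow> f T = f' T" "\<And>T. T \<subseteq> S \<Longrightarrow> g T = g' T"
  shows "subset_conv f g S = subset_conv f' g' S"
  unfolding subset_conv_def using assms by (intro sum.cong) auto

text \<open>The substitution t_k -> c_k t_k is multiplicative: \<open>T\<close> and
  \<open>S - T\<close> share out the factors belonging to \<open>S\<close>.\<close>

lemma subset_conv_scale: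
  assumes "finite S"
  shows "subset_conv (\<lambda>T. (\<Prod>k\<in>T. c k) * f T) (\<lambda>T. (\<Prod>k\<in>T. c k) * g T) S
    = (\<Prod>k\<in>S. c k) * subset_conv f g S"
proof -
  have "(\<Prod>k\<in>T. c k) * f T * ((\<Prod>k\<in>S - T. c k) * g (S - T))
      = (\<Prod>k\<in>S. c k) * (f T * g (S - T))" if "T \<subseteq> S" for T
    using prod.subset_diff[OF that assms, of c] by (simp add: mult_ac)
  then show ?thesis
    unfolding subset_conv_def sum_distrib_left by (intro sum.cong) auto
qed

definition set_unit :: "'a set \<Rightarrow> 'b::comm_ring_1" where
  "set_unit S = (if S = {} then 1 else 0)"

lemma subset_conv_unit_left:
  assumes "finite S"
  shows "subset_conv set_unit f S = f S"
proof -
  have "subset_conv set_unit f S = (\<Sum>T\<in>Pow S. if T = {} then f S else 0)"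
    unfolding subset_conv_def set_unit_def by (rule sum.cong) auto
  then show ?thesis using assms by simp
qed

lemma subset_conv_unit_conv:
  assumes "finite S" "\<And>T. finite T \<Longrightarrow> u T = set_unit T"
  shows "subset_conv u f S = f S"
proof -
  have "subset_conv u f S = subset_conv set_unit f S"
    using assms finite_subset by (intro subset_conv_cong) blast+
  then show ?thesis using assms(1) by (simp add: subset_conv_unit_left)
qed

section \<open>Derivation and inverse in the algebra of set functions\<close>

definition restrict_containing :: "'a \<Rightarrow> ('a set \<Rightarrow> 'b::comm_ring_1) \<Rightarrow> 'a set \<Rightarrow> 'b" where
  "restrict_containing k f S = (if k \<in> S then f S else 0)"

text \<open>Leibniz rule: an element of \<open>S\<close> lies in exactly one of \<open>T\<close> and
  \<open>S - T\<close>.\<close>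

lemma restrict_containing_conv:
  "restrict_containing k (subset_conv f g) S
    = subset_conv (restrict_containing k f) g S + subset_conv f (restrict_containing k g) S"
proof (cases "k \<in> S")
  case True
  then show ?thesis
    unfolding subset_conv_def restrict_containing_def sum.distrib[symmetric] by simp (rule sum.cong, auto)
next
  case False
  then have "k \<notin> T" if "T \<in> Pow S" for T using that by auto
  with False show ?thesis
    unfolding subset_conv_def restrict_containing_def by simp
qed

text \<open>For \<open>f {} = 1\<close> this is the geometric series \<Sum> (-1)^m (f - 1)^m: the
  m-th power of f - 1 counts every partition into m blocks m! times, once for each order of the
  blocks.\<close>

definition set_inverse :: "('a set \<Rightarrow> 'b::comm_ring_1) \<Rightarrow> 'a set \<Rightarrow> 'b" where
  "set_inverse f S =
    (\<Sum>P | partition_on S P. of_nat (fact (card P)) * (-1) ^ card P * (\<Prod>b\<in>P. f b))"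

text \<open>A nonempty block \<open>T\<close> together with a partition of the rest is the same
  thing as a partition of \<open>S\<close> with one block marked.\<close>

lemma sum_pointed_partitions:
  assumes "finite S"
  shows "(\<Sum>T\<in>Pow S - {{}}. \<Sum>P | partition_on (S - T) P. w T (insert T P))
    = (\<Sum>Q | partition_on S Q. \<Sum>T\<in>Q. w T Q)"
proof -
  have part: "partition_on S (insert T P)" if "T \<subseteq> S" "T \<noteq> {}" "partition_on (S - T) P" for T P
    using partition_on_insert[of T P S] that partition_onD1[OF that(3)]
    by (auto simp: disjnt_def)
  have sub: "T \<subseteq> S" "T \<noteq> {}" if "partition_on S Q" "T \<in> Q" for T Q
    using that partition_onD1[OF that(1)] partition_onD3[OF that(1)] by auto
  have nin: "T \<notin> P" if "x \<in> T" "partition_on (S - T) P" for T P x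
    using partition_onD1[OF that(2)] that(1) by blast
  have rem: "partition_on (S - T) (Q - {T})" if "partition_on S Q" "T \<in> Q" for T Q
  proof -
    have "disjnt T (\<Union>(Q - {T}))"
      using that partition_onD2[OF that(1)] by (auto simp: disjnt_def disjoint_def)
    then show ?thesis
      using partition_on_insert[of T "Q - {T}" S] that by (simp add: insert_absorb)
  qed
  have "(\<Sum>T\<in>Pow S - {{}}. \<Sum>P | partition_on (S - T) P. w T (insert T P))
      = (\<Sum>(T, P)\<in>(SIGMA T:Pow S - {{}}. {P. partition_on (S - T) P}). w T (insert T P))"
    using assms by (intro sum.Sigma) (auto intro!: finitely_many_partition_on)
  also have "\<dots> = (\<Sum>(Q, T)\<in>(SIGMA Q:{Q. partition_on S Q}. Q). w T Q)"
    by (rule sum.reindex_bij_witness[where i = "\<lambda>(Q, T). (T, Q - {T})" and j = "\<lambda>(T, P). (insert T P, T)"])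
      (auto simp: insert_absorb rem dest: sub nin intro: part)
  also have "\<dots> = (\<Sum>Q | partition_on S Q. \<Sum>T\<in>Q. w T Q)"
    using assms finite_elements by (intro sum.Sigma[symmetric]) (auto intro!: finitely_many_partition_on)
  finally show ?thesis .
qed

text \<open>The summand of \<open>cumulant\<close>. Its \<open>card P - 1\<close> counts the blocks
  other than a marked one, which matches the weights in \<open>set_inverse\<close>.\<close>

definition partition_weight :: "('a set \<Rightarrow> 'b::comm_ring_1) \<Rightarrow> 'a set set \<Rightarrow> 'b" where
  "partition_weight f P = of_nat (fact (card P - 1)) * (-1) ^ (card P - 1) * (\<Prod>b\<in>P. f b)"

text \<open>With \<open>T\<close> marked, \<open>f T\<close> times the \<open>set_inverse\<close>
  term of the remaining blocks is the \<open>partition_weight\<close> of the whole partition. The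
  constant \<open>c = 1\<close> leads to the inverse property, the indicator of containing
  \<open>k\<close> to the cumulant.\<close>

lemma sum_conv_inverse:
  assumes "finite S"
  shows "(\<Sum>T\<in>Pow S - {{}}. c T * f T * set_inverse f (S - T))
    = (\<Sum>Q | partition_on S Q. (\<Sum>T\<in>Q. c T) * partition_weight f Q)"
proof -
  have "c T * f T * set_inverse f (S - T)
      = (\<Sum>P | partition_on (S - T) P. c T * partition_weight f (insert T P))"
    if "T \<in> Pow S - {{}}" for T
    unfolding set_inverse_def sum_distrib_left
  proof (rule sum.cong)
    fix P assume "P \<in> {P. partition_on (S - T) P}"
    then have P: "partition_on (S - T) P" by simp
    have "T \<notin> P" "finite P"
      using that partition_onD1[OF P] finite_elements[OF _ P] assms by blast+
    then show "c T * f T * (of_nat (fact (card P)) * (- 1) ^ card P * (\<Prod>b\<in>P. f b))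
        = c T * partition_weight f (insert T P)"
      by (simp add: partition_weight_def algebra_simps)
  qed simp
  then show ?thesis
    using sum_pointed_partitions[OF assms, of "\<lambda>T Q. c T * partition_weight f Q"]
    by (simp add: sum_distrib_right)
qed

lemma set_inverse_conv:
  assumes "finite S" "f {} = 1"
  shows "subset_conv f (set_inverse f) S = set_unit S"
proof (cases "S = {}")
  case True
  then show ?thesis
    using assms by (simp add: subset_conv_def set_inverse_def set_unit_def partition_on_empty)
next
  case False
  \<comment> \<open>Counting the marked blocks turns (m - 1)! into m! for m = \<open>card Q\<close>,
    and the sign flips. The nonempty \<open>T\<close> therefore cancel the term at
    \<open>{}\<close>.\<close>
  have "(\<Sum>T\<in>Q. 1) * partition_weight f Q
      = - (of_nat (fact (card Q)) * (-1) ^ card Q * (\<Prod>b\<in>Q. f b))" if Q: "partition_on S Q" for Q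
  proof -
    obtain m where m: "card Q = Suc m"
      using False finite_elements[OF assms(1) Q] partition_onD1[OF Q]
      by (cases "card Q") auto
    show ?thesis by (simp add: partition_weight_def m algebra_simps)
  qed
  then have "(\<Sum>T\<in>Pow S - {{}}. f T * set_inverse f (S - T)) = - set_inverse f S"
    using sum_conv_inverse[OF assms(1), of "\<lambda>_. 1" f]
    by (simp add: set_inverse_def sum_negf)
  moreover have "subset_conv f (set_inverse f) S
      = f {} * set_inverse f S + (\<Sum>T\<in>Pow S - {{}}. f T * set_inverse f (S - T))"
    unfolding subset_conv_def using assms(1) by (subst sum.remove[of _ "{}"]) auto
  ultimately show ?thesis using assms False by (simp add: set_unit_def)
qed

text \<open>The cumulant is the logarithm of \<open>f\<close> in the algebra of set functions, and
  \<open>restrict_containing k\<close> is the derivation \<open>t\<^sub>k \<partial>/\<partial>t\<^sub>k\<close>; this is the logarithmic derivative.\<close>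

lemma cumulant_eq_log_derivative:
  fixes f :: "nat set \<Rightarrow> 'a::comm_ring_1"
  assumes "k \<in> {1..n}"
  shows "cumulant n f = subset_conv (restrict_containing k f) (set_inverse f) {1..n}"
proof -
  \<comment> \<open>Exactly one block of a partition contains \<open>k\<close>; marking it counts
    every partition once.\<close>
  have "(\<Sum>T\<in>Q. of_bool (k \<in> T)) = (1 :: 'a)" if Q: "partition_on {1..n} Q" for Q
  proof -
    obtain B where B: "B \<in> Q" "k \<in> B"
      using assms partition_onD1[OF Q] by blast
    have "finite Q" using finite_elements[OF _ Q] by simp
    have "k \<in> T \<longleftrightarrow> T = B" if "T \<in> Q" for T
      using that B partition_onD2[OF Q] by (auto simp: disjoint_def)
    then have "(\<Sum>T\<in>Q. of_bool (k \<in> T)) = (\<Sum>T\<in>Q. if T = B then 1 else (0 :: 'a))"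
      by (intro sum.cong) simp_all
    then show ?thesis using B \<open>finite Q\<close> by simp
  qed
  then have "cumulant n f
      = (\<Sum>T\<in>Pow {1..n} - {{}}. of_bool (k \<in> T) * f T * set_inverse f ({1..n} - T))"
    by (simp add: sum_conv_inverse[of "{1..n}" "\<lambda>T. of_bool (k \<in> T)" f, simplified]
        cumulant_def partition_weight_def)
  also have "\<dots> = subset_conv (restrict_containing k f) (set_inverse f) {1..n}"
    unfolding subset_conv_def
    by (rule sum.mono_neutral_cong_left) (auto simp: restrict_containing_def)
  finally show ?thesis .
qed

text \<open>Logarithmic derivatives add: D(fg)/(fg) = Df/f + Dg/g. The derivation is taken at the
  element 1, which belongs to \<open>{1..n}\<close> since n \<ge> 1.\<close>

theorem cumulant_subset_conv:
  assumes "n \<ge> 1" "f {} = 1" "g {} = 1"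
  shows "cumulant n (subset_conv f g) = cumulant n f + cumulant n g"
proof -
  let ?D = "restrict_containing 1" and ?S = "{1..n}"
  define h where "h = subset_conv f g"
  have h1: "h {} = 1" using assms by (simp add: h_def subset_conv_def)
  have inv: "subset_conv f (set_inverse f) T = set_unit T"
    "subset_conv g (set_inverse g) T = set_unit T"
    "subset_conv (set_inverse h) h T = set_unit T" if "finite T" for T
    using set_inverse_conv[OF that] assms h1 subset_conv_commute[of _ h] by auto
  have fin: "finite T" if "T \<subseteq> ?S" for T using that finite_subset by blast
  \<comment> \<open>Uniqueness of inverses: the product of the two inverses also inverts
    \<open>h\<close>. Finiteness of \<open>T\<close> gives access to the unit law.\<close>
  have inv_h: "set_inverse h T = subset_conv (set_inverse f) (set_inverse g) T" if "finite T" for T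
  proof -
    let ?p = "subset_conv (set_inverse f) (set_inverse g)"
    have "subset_conv h ?p = subset_conv (subset_conv f (set_inverse f)) (subset_conv g (set_inverse g))"
      unfolding h_def by (metis subset_conv_assoc subset_conv_commute)
    then have "subset_conv h ?p T' = set_unit T'" if "finite T'" for T'
      using that inv by (simp add: subset_conv_unit_conv)
    then have "set_inverse h T = subset_conv (subset_conv h ?p) (set_inverse h) T"
      using that by (simp add: subset_conv_unit_conv)
    also have "\<dots> = subset_conv (subset_conv (set_inverse h) h) ?p T"
      by (metis subset_conv_assoc subset_conv_commute)
    also have "\<dots> = ?p T"
      using that inv by (simp add: subset_conv_unit_conv)
    finally show ?thesis .
  qed
  have "cumulant n h = subset_conv (?D h) (set_inverse h) ?S"
    using assms(1) by (intro cumulant_eq_log_derivative) simp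
  also have "\<dots> = subset_conv (\<lambda>T. subset_conv (?D f) g T + subset_conv f (?D g) T)
      (subset_conv (set_inverse f) (set_inverse g)) ?S"
    by (rule subset_conv_cong) (auto simp: h_def restrict_containing_conv inv_h[unfolded h_def] fin)
  also have "\<dots> = subset_conv (subset_conv (?D f) g) (subset_conv (set_inverse f) (set_inverse g)) ?S
      + subset_conv (subset_conv f (?D g)) (subset_conv (set_inverse f) (set_inverse g)) ?S"
    by (simp add: subset_conv_def distrib_right sum.distrib)
  also have "subset_conv (subset_conv (?D f) g) (subset_conv (set_inverse f) (set_inverse g))
      = subset_conv (subset_conv g (set_inverse g)) (subset_conv (?D f) (set_inverse f))"
    by (metis subset_conv_assoc subset_conv_commute)
  also have "\<dots> ?S = cumulant n f"
    using assms(1) by (simp add: subset_conv_unit_conv inv cumulant_eq_log_derivative[of 1])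
  also have "subset_conv (subset_conv f (?D g)) (subset_conv (set_inverse f) (set_inverse g))
      = subset_conv (subset_conv f (set_inverse f)) (subset_conv (?D g) (set_inverse g))"
    by (metis subset_conv_assoc subset_conv_commute)
  also have "\<dots> ?S = cumulant n g"
    using assms(1) by (simp add: subset_conv_unit_conv inv cumulant_eq_log_derivative[of 1])
  finally show ?thesis by (simp add: h_def)
qed

section \<open>Rules for computing cumulants\<close>

lemma cumulant_cong:
  assumes "\<And>b. b \<subseteq> {1..n} \<Longrightarrow> b \<noteq> {} \<Longrightarrow> f b = g b"
  shows "cumulant n f = cumulant n g"
  unfolding cumulant_def
proof (rule sum.cong)
  fix P assume "P \<in> {P. partition_on {1..n} P}"
  then have P: "partition_on {1..n} P" by simp
  have "b \<subseteq> {1..n}" "b \<noteq> {}" if "b \<in> P" for b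
    using that partition_onD1[OF P] partition_onD3[OF P] by auto
  then have "(\<Prod>b\<in>P. f b) = (\<Prod>b\<in>P. g b)"
    using assms by (intro prod.cong) auto
  then show "of_nat (fact (card P - 1)) * (- 1) ^ (card P - 1) * (\<Prod>b\<in>P. f b)
      = of_nat (fact (card P - 1)) * (- 1) ^ (card P - 1) * (\<Prod>b\<in>P. g b)" by simp
qed simp

lemma cumulant_eq_0:
  assumes "\<And>P. partition_on {1..n} P \<Longrightarrow> \<exists>b\<in>P. f b = 0"
  shows "cumulant n f = 0"
  unfolding cumulant_def
proof (rule sum.neutral, safe)
  fix P assume P: "partition_on {1..n} P"
  then have "finite P" using finite_elements by blast
  then have "(\<Prod>b\<in>P. f b) = 0"
    using assms[OF P] by (rule prod_zero)
  then show "of_nat (fact (card P - 1)) * (- 1) ^ (card P - 1) * (\<Prod>b\<in>P. f b) = 0"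
    by simp
qed

text \<open>The cumulant is a polynomial with integer coefficients in the values of
  \<open>f\<close>, so ring homomorphisms pass through it.\<close>

lemma cumulant_hom:
  assumes add: "\<And>x y. h (x + y) = h x + h y" and mult: "\<And>x y. h (x * y) = h x * h y"
    and one: "h 1 = 1"
  shows "h (cumulant n f) = cumulant n (\<lambda>b. h (f b))"
proof -
  have h0: "h 0 = 0" using add[of 0 0] by simp
  have hm: "h (- 1) = - 1" using add[of 1 "- 1"] one h0 by (simp add: eq_neg_iff_add_eq_0 add.commute)
  have sum: "h (\<Sum>x\<in>X. F x) = (\<Sum>x\<in>X. h (F x))" for X :: "nat set set set" and F
    by (induction X rule: infinite_finite_induct) (auto simp: h0 add)
  have prod: "h (\<Prod>x\<in>X. F x) = (\<Prod>x\<in>X. h (F x))" for X :: "nat set set" and F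
    by (induction X rule: infinite_finite_induct) (auto simp: one mult)
  have pow: "h (x ^ m) = h x ^ m" for x m by (induction m) (auto simp: one mult)
  have nat: "h (of_nat m) = of_nat m" for m by (induction m) (auto simp: h0 one add)
  show ?thesis unfolding cumulant_def sum mult pow prod nat hm ..
qed

text \<open>Each \<open>k\<close> lies in exactly one block, so every partition collects each factor
  \<open>c k\<close> once.\<close>

lemma cumulant_scale:
  "cumulant n (\<lambda>b. (\<Prod>k\<in>b. c k) * f b) = (\<Prod>k=1..n. c k) * cumulant n f"
  unfolding cumulant_def sum_distrib_left
proof (rule sum.cong)
  fix P assume "P \<in> {P. partition_on {1..n} P}"
  then have P: "partition_on {1..n} P" by simp
  have "b \<subseteq> {1..n}" if "b \<in> P" for b
    using that partition_onD1[OF P] by blast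
  then have "\<forall>b\<in>P. finite b"
    using finite_subset by blast
  then have "(\<Prod>b\<in>P. \<Prod>k\<in>b. c k) = (\<Prod>k=1..n. c k)"
    using prod.Union_disjoint[of P c] partition_onD1[OF P] partition_onD2[OF P]
    by (auto simp: disjoint_def)
  then show "of_nat (fact (card P - 1)) * (- 1) ^ (card P - 1) * (\<Prod>b\<in>P. (\<Prod>k\<in>b. c k) * f b)
      = (\<Prod>k=1..n. c k) * (of_nat (fact (card P - 1)) * (- 1) ^ (card P - 1) * (\<Prod>b\<in>P. f b))"
    by (simp add: prod.distrib mult_ac)
qed simp

text \<open>The logarithm of the unit is 0: every partition of a nonempty set has a nonempty block,
  where \<open>set_unit\<close> vanishes.\<close>

lemma cumulant_set_unit:
  assumes "n \<ge> 1"
  shows "cumulant n set_unit = (0 :: 'b::comm_ring_1)"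
proof (rule cumulant_eq_0)
  fix P assume P: "partition_on {1..n} P"
  then obtain B where "B \<in> P" using assms partition_onD1[OF P] by fastforce
  moreover from this have "B \<noteq> {}" using partition_onD3[OF P] by auto
  ultimately show "\<exists>b\<in>P. set_unit b = (0 :: 'b)" by (auto simp: set_unit_def)
qed

lemma cumulant_cnj: "cumulant n (\<lambda>b. cnj (g b)) = cnj (cumulant n g)"
  by (rule cumulant_hom[symmetric]) simp_all

lemma cumulant_1: "cumulant 1 f = f {1}"
proof -
  have "partition_on {1} P \<longleftrightarrow> P = {{1}}" for P :: "nat set set"
  proof
    assume P: "partition_on {1} P"
    have "b = {1}" if "b \<in> P" for b
      using that partition_onD1[OF P] partition_onD3[OF P] by (metis Union_upper subset_singletonD)
    then have "P \<subseteq> {{1}}" by blast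
    moreover have "P \<noteq> {}" using partition_onD1[OF P] by auto
    ultimately show "P = {{1}}" by blast
  qed (simp add: partition_on_space)
  then show ?thesis by (simp add: cumulant_def)
qed

text \<open>Away from \<open>{}\<close>, \<open>f\<close> is the product of \<open>u\<close>, which
  involves only t_k, and \<open>v\<close>, which involves only the other variables. The logarithm is
  then a sum without mixed terms.\<close>

lemma cumulant_independent:
  assumes "n \<ge> 2" "k \<in> {1..n}"
    and ins: "\<And>b. b \<subseteq> {1..n} - {k} \<Longrightarrow> b \<noteq> {} \<Longrightarrow> f (insert k b) = f b * f {k}"
  shows "cumulant n f = 0"
proof -
  define u where "u b = (if b = {} then 1 else if b = {k} then f {k} else 0)" for b
  define v where "v b = (if b = {} then 1 else if k \<in> b then 0 else f b)" for b
  have "subset_conv u v b = f b" if b: "b \<subseteq> {1..n}" "b \<noteq> {}" for b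
  proof -
    have "finite b" using b finite_subset by blast
    then have "subset_conv u v b = (\<Sum>T\<in>{{}, {k}} \<inter> Pow b. u T * v (b - T))"
      unfolding subset_conv_def by (intro sum.mono_neutral_right) (auto simp: u_def)
    also have "\<dots> = f b"
    proof (cases "k \<in> b")
      case True
      then have "{{}, {k}} \<inter> Pow b = {{}, {k}}" by auto
      moreover have "f b = f (b - {k}) * f {k}" if "b \<noteq> {k}"
        using ins[of "b - {k}"] that True b by (auto simp: insert_absorb)
      moreover have "f b = f {k}" if "b - {k} = {}"
        using that True by (auto intro!: arg_cong[where f = f])
      ultimately show ?thesis using True b by (cases "b = {k}") (auto simp: u_def v_def mult.commute)
    next
      case False
      then have "{{}, {k}} \<inter> Pow b = {{}}" by auto
      then show ?thesis using False b by (simp add: u_def v_def)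
    qed
    finally show ?thesis .
  qed
  then have "cumulant n f = cumulant n (subset_conv u v)"
    by (intro cumulant_cong) simp
  also have "\<dots> = cumulant n u + cumulant n v"
    using assms(1) by (intro cumulant_subset_conv) (auto simp: u_def v_def)
  also have "cumulant n u = 0"
  proof (rule cumulant_eq_0)
    fix P assume P: "partition_on {1..n} P"
    \<comment> \<open>Here n \<ge> 2 enters: the block of an index other than \<open>k\<close> is
      neither \<open>{}\<close> nor \<open>{k}\<close>, so \<open>u\<close> vanishes on it.\<close>
    obtain j where j: "j \<in> {1..n}" "j \<noteq> k"
      using assms(1,2) by (cases "k = 1") (auto intro: that[of 1] that[of 2])
    then obtain b where "b \<in> P" "j \<in> b" using partition_onD1[OF P] by blast
    with j show "\<exists>b\<in>P. u b = 0" by (auto simp: u_def)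
  qed
  also have "cumulant n v = 0"
  proof (rule cumulant_eq_0)
    fix P assume P: "partition_on {1..n} P"
    then obtain b where "b \<in> P" "k \<in> b" using partition_onD1[OF P] assms(2) by blast
    then show "\<exists>b\<in>P. v b = 0" by (auto simp: v_def)
  qed
  finally show ?thesis by simp
qed

subsection \<open>Coefficients of power series\<close>

lemma keys_add_nat: "Poly_Mapping.keys (a + c) = Poly_Mapping.keys a \<union> Poly_Mapping.keys c"
  for a c :: monomial
  by (auto simp: in_keys_iff lookup_add)

definition squarefree_monomial :: "nat set \<Rightarrow> monomial" where
  "squarefree_monomial S = (\<Sum>k\<in>S. Poly_Mapping.single k 1)"

lemma lookup_squarefree_monomial:
  assumes "finite S"
  shows "Poly_Mapping.lookup (squarefree_monomial S) k = of_bool (k \<in> S)"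
  unfolding squarefree_monomial_def using assms
  by (induction S) (auto simp: lookup_add lookup_single when_def)

lemma keys_squarefree_monomial:
  "finite S \<Longrightarrow> Poly_Mapping.keys (squarefree_monomial S) = S"
  by (auto simp: in_keys_iff lookup_squarefree_monomial)

lemma squarefree_monomial_empty [simp]: "squarefree_monomial {} = 0"
  by (simp add: squarefree_monomial_def)

lemma squarefree_monomial_Un:
  assumes "finite S" "finite T" "S \<inter> T = {}"
  shows "squarefree_monomial (S \<union> T) = squarefree_monomial S + squarefree_monomial T"
  unfolding squarefree_monomial_def by (rule sum.union_disjoint[OF assms])

text \<open>Every occurring variable contributes at least 1 to the degree, so the bound leaves room
  for no further variable and no exponent above 1.\<close>

lemma total_degree_le_imp_squarefree:
  assumes "finite S" "S \<subseteq> Poly_Mapping.keys e" "total_degree e \<le> card S"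
  shows "e = squarefree_monomial S"
proof -
  have pos: "Poly_Mapping.lookup e k \<ge> 1" if "k \<in> Poly_Mapping.keys e" for k
    using that by (simp add: in_keys_iff)
  have "card (Poly_Mapping.keys e) \<le> total_degree e"
    unfolding total_degree_def card_eq_sum using pos by (intro sum_mono) auto
  then have keys: "S = Poly_Mapping.keys e"
    using assms by (intro card_seteq) auto
  have eq: "Poly_Mapping.lookup e k = 1" if "k \<in> S" for k
  proof (rule ccontr)
    assume "Poly_Mapping.lookup e k \<noteq> 1"
    then have "(\<Sum>j\<in>S. 1) < (\<Sum>j\<in>S. Poly_Mapping.lookup e j)"
      using that pos[of k] pos assms(1) unfolding keys by (intro sum_strict_mono_ex1) force+
    then show False using assms(3) by (simp add: total_degree_def keys)
  qed
  show ?thesis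
    by (rule poly_mapping_eqI)
      (use eq keys assms(1) in \<open>auto simp: lookup_squarefree_monomial in_keys_iff\<close>)
qed

text \<open>Exponents 0 and 1 cannot be shared, so a splitting hands each variable of
  \<open>S\<close> to one of the two factors.\<close>

lemma sum_splittings_squarefree:
  assumes "finite S"
  shows "(\<Sum>(a, c)\<in>splittings (squarefree_monomial S). F a c)
    = (\<Sum>T\<in>Pow S. F (squarefree_monomial T) (squarefree_monomial (S - T)))"
proof -
  have keys: "a = squarefree_monomial (Poly_Mapping.keys a)"
      "c = squarefree_monomial (S - Poly_Mapping.keys a)" "Poly_Mapping.keys a \<subseteq> S"
    if "a + c = squarefree_monomial S" for a c
  proof -
    have eq: "Poly_Mapping.lookup a k + Poly_Mapping.lookup c k = of_bool (k \<in> S)" for k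
      using that assms by (metis lookup_add lookup_squarefree_monomial)
    show sub: "Poly_Mapping.keys a \<subseteq> S"
    proof
      fix k assume "k \<in> Poly_Mapping.keys a"
      then show "k \<in> S" using eq[of k] by (cases "k \<in> S") (auto simp: in_keys_iff)
    qed
    have fin: "finite (Poly_Mapping.keys a)" "finite (S - Poly_Mapping.keys a)" using assms by auto
    show "a = squarefree_monomial (Poly_Mapping.keys a)"
    proof (rule poly_mapping_eqI)
      fix k
      show "Poly_Mapping.lookup a k = Poly_Mapping.lookup (squarefree_monomial (Poly_Mapping.keys a)) k"
        using eq[of k] by (cases "k \<in> S") (auto simp: lookup_squarefree_monomial in_keys_iff)
    qed
    show "c = squarefree_monomial (S - Poly_Mapping.keys a)"
    proof (rule poly_mapping_eqI)
      fix k
      show "Poly_Mapping.lookup c k = Poly_Mapping.lookup (squarefree_monomial (S - Poly_Mapping.keys a)) k"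
        using eq[of k] assms by (cases "k \<in> S") (auto simp: lookup_squarefree_monomial in_keys_iff)
    qed
  qed
  have split: "squarefree_monomial T + squarefree_monomial (S - T) = squarefree_monomial S"
    if "T \<subseteq> S" for T
    using squarefree_monomial_Un[of T "S - T"] that assms finite_subset[OF that]
    by (simp add: Un_absorb1)
  show ?thesis
    by (rule sum.reindex_bij_witness[where
          i = "\<lambda>T. (squarefree_monomial T, squarefree_monomial (S - T))" and
          j = "\<lambda>(a, c). Poly_Mapping.keys a"])
      (auto simp: splittings_def keys_squarefree_monomial split finite_subset[OF _ assms]
        simp flip: keys(1,2) dest: keys(3)[THEN subsetD])
qed

text \<open>Reading off squarefree coefficients is thus multiplicative from power series to set
  functions.\<close>

lemma mps_coeff_mult_squarefree:
  assumes "finite S"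
  shows "mps_coeff (f * g) (squarefree_monomial S) = subset_conv
    (\<lambda>T. mps_coeff f (squarefree_monomial T)) (\<lambda>T. mps_coeff g (squarefree_monomial T)) S"
  using sum_splittings_squarefree[OF assms, of "\<lambda>a c. mps_coeff f a * mps_coeff g c"]
  by (simp add: times_mpseries.rep_eq subset_conv_def)

lemma splittings_0: "splittings 0 = {(0, 0)}"
proof -
  have zero: "a = 0 \<and> c = 0" if "a + c = 0" for a c :: monomial
  proof -
    have "total_degree a + total_degree c = 0"
      unfolding total_degree_add[symmetric] total_degree_eq_0_iff by (rule that)
    then show ?thesis by (simp add: total_degree_eq_0_iff)
  qed
  show ?thesis by (auto simp: splittings_def dest: zero)
qed

lemma mps_coeff_mult_0: "mps_coeff (f * g) 0 = mps_coeff f 0 * mps_coeff g 0"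
  by (simp add: times_mpseries.rep_eq splittings_0)

lemma mps_coeff_Abs [simp]: "mps_coeff (Abs_mpseries F) = F"
  by (simp add: Abs_mpseries_inverse)

lemma mps_coeff_sum: "mps_coeff (\<Sum>x\<in>X. F x) e = (\<Sum>x\<in>X. mps_coeff (F x) e)"
  by (induction X rule: infinite_finite_induct) (auto simp: zero_mpseries.rep_eq plus_mpseries.rep_eq)

lemma mps_coeff_const_mult: "mps_coeff (mps_const z * f) e = z * mps_coeff f e"
proof -
  have "mps_coeff (mps_const z * f) e = (\<Sum>p\<in>splittings e. if p = (0, e) then z * mps_coeff f e else 0)"
    unfolding times_mpseries.rep_eq mps_const.rep_eq
    by (rule sum.cong) (auto simp: splittings_def split: if_splits)
  then show ?thesis
    by (simp add: finite_splittings) (simp add: splittings_def)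
qed

lemma mps_const_add: "mps_const (x + y) = mps_const x + mps_const y"
  by (rule mps_eqI) (simp add: plus_mpseries.rep_eq mps_const.rep_eq)

lemma mps_const_mult: "mps_const (x * y) = mps_const x * mps_const y"
  by (rule mps_eqI) (simp only: mps_coeff_const_mult, simp add: mps_const.rep_eq)

lemma mps_const_0: "mps_const 0 = 0"
  by (rule mps_eqI) (simp add: mps_const.rep_eq zero_mpseries.rep_eq)

lemma mps_const_1: "mps_const 1 = 1"
  by (rule mps_eqI) (simp add: mps_const.rep_eq one_mpseries.rep_eq)

lemma mps_const_of_nat: "mps_const (of_nat m) = of_nat m"
  by (induction m) (simp_all add: mps_const_0 mps_const_1 mps_const_add)

text \<open>With \<open>mps_const_of_nat\<close>, this lets the numerical factor of a cumulant term
  be read as a constant series and pulled out of a coefficient.\<close>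

lemma mps_const_neg_1_power: "mps_const ((-1) ^ m) = (-1) ^ m"
proof (induction m)
  case (Suc m)
  have "mps_const (- 1) = - 1"
    by (rule mps_eqI) (simp add: mps_const.rep_eq one_mpseries.rep_eq uminus_mpseries.rep_eq)
  with Suc show ?case by (simp only: power_Suc mps_const_mult)
qed (simp add: mps_const_1)

lemma mps_coeff_prod_var:
  assumes "finite S"
  shows "mps_coeff (\<Prod>k\<in>S. mps_var k) e = of_bool (e = squarefree_monomial S)"
  using assms
proof (induction S arbitrary: e)
  case empty
  then show ?case by (simp add: one_mpseries.rep_eq)
next
  case (insert k S)
  have "mps_coeff (mps_var k * (\<Prod>k\<in>S. mps_var k)) e
      = (\<Sum>p\<in>splittings e. if p = (Poly_Mapping.single k 1, squarefree_monomial S) then 1 else 0)"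
    unfolding times_mpseries.rep_eq by (rule sum.cong) (auto simp: mps_var.rep_eq insert split: if_splits)
  also have "\<dots> = of_bool (e = squarefree_monomial (insert k S))"
    using insert by (subst sum.delta[OF finite_splittings])
      (auto simp: squarefree_monomial_def splittings_def)
  finally show ?case using insert by simp
qed

section \<open>Setting the variables outside a set to zero\<close>

definition mps_restrict :: "nat set \<Rightarrow> mpseries \<Rightarrow> mpseries" where
  "mps_restrict V f = Abs_mpseries (\<lambda>e. if Poly_Mapping.keys e \<subseteq> V then mps_coeff f e else 0)"

lemma mps_coeff_restrict:
  "mps_coeff (mps_restrict V f) e = (if Poly_Mapping.keys e \<subseteq> V then mps_coeff f e else 0)"
  by (simp add: mps_restrict_def)

lemma mps_restrict_add: "mps_restrict V (f + g) = mps_restrict V f + mps_restrict V g"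
  by (rule mps_eqI) (simp add: mps_coeff_restrict plus_mpseries.rep_eq)

lemma mps_restrict_1: "mps_restrict V 1 = 1"
  by (rule mps_eqI) (simp add: mps_coeff_restrict one_mpseries.rep_eq)

text \<open>A product of monomials involves only variables in \<open>V\<close> iff both factors
  do.\<close>

lemma mps_restrict_mult: "mps_restrict V (f * g) = mps_restrict V f * mps_restrict V g"
proof (rule mps_eqI)
  fix e
  have "mps_coeff (mps_restrict V f * mps_restrict V g) e = (\<Sum>(a, c)\<in>splittings e.
      if Poly_Mapping.keys e \<subseteq> V then mps_coeff f a * mps_coeff g c else 0)"
    unfolding times_mpseries.rep_eq mps_coeff_restrict
    by (rule sum.cong) (auto simp: splittings_def keys_add_nat)
  then show "mps_coeff (mps_restrict V (f * g)) e = mps_coeff (mps_restrict V f * mps_restrict V g) e"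
    by (simp add: mps_coeff_restrict times_mpseries.rep_eq)
qed

text \<open>The equation \<open>mps_restrict V f = f\<close> expresses that \<open>f\<close>
  involves only variables in \<open>V\<close>.\<close>

lemma mps_restrict_subset:
  "mps_restrict V f = f \<Longrightarrow> V \<subseteq> W \<Longrightarrow> mps_restrict W f = f"
  by (metis (no_types, lifting) mps_coeff_restrict mps_eqI subset_trans)

text \<open>The series \<open>mps_div 1 g\<close> inverts \<open>g\<close>, so \<open>g\<close> can
  be cancelled.\<close>

lemma mps_div_unique:
  assumes "mps_coeff g 0 \<noteq> 0" "q * g = f"
  shows "q = mps_div f g"
proof -
  have "mps_div 1 g * g = 1" using assms(1) by (rule mps_div_mult)
  moreover have "mps_div f g * g = q * g" using mps_div_mult[OF assms(1)] assms(2) by simp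
  ultimately show ?thesis by (metis mult.assoc mult.commute mult.right_neutral)
qed

text \<open>Since the factors have disjoint variables, the monomial of the union arises only from
  the full monomial of each block. The second conjunct supplies, in the induction, the variables of
  the product over \<open>P\<close>.\<close>

lemma mps_coeff_prod_disjoint:
  assumes "finite P" "disjoint P" "\<And>b. b \<in> P \<Longrightarrow> finite b"
    and "\<And>b. b \<in> P \<Longrightarrow> mps_restrict b (f b) = f b"
  shows "mps_coeff (\<Prod>b\<in>P. f b) (squarefree_monomial (\<Union>P))
      = (\<Prod>b\<in>P. mps_coeff (f b) (squarefree_monomial b))
    \<and> mps_restrict (\<Union>P) (\<Prod>b\<in>P. f b) = (\<Prod>b\<in>P. f b)"
  using assms
proof (induction P)
  case empty
  then show ?case by (simp add: one_mpseries.rep_eq mps_restrict_1)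
next
  case (insert B P)
  let ?C = "\<Union>P" and ?g = "\<Prod>b\<in>P. f b"
  let ?F = "\<lambda>T. mps_coeff (f B) (squarefree_monomial T)"
  let ?G = "\<lambda>T. mps_coeff ?g (squarefree_monomial T)"
  have IH: "?G ?C = (\<Prod>b\<in>P. mps_coeff (f b) (squarefree_monomial b))" "mps_restrict ?C ?g = ?g"
    using insert by (auto simp: pairwise_insert)
  have fin: "finite B" "finite ?C" using insert by auto
  have disj: "B \<inter> ?C = {}"
    using insert.prems(1) insert.hyps(2) by (auto simp: disjoint_def)
  have F0: "?F T = 0" if "T \<subseteq> B \<union> ?C" "\<not> T \<subseteq> B" for T
    using that insert.prems(3)[of B] fin finite_subset[OF that(1)]
    by (metis finite_UnI insertI1 keys_squarefree_monomial mps_coeff_restrict)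
  have G0: "?G T = 0" if "T \<subseteq> B \<union> ?C" "\<not> T \<subseteq> ?C" for T
    using that IH(2) fin finite_subset[OF that(1)]
    by (metis finite_UnI keys_squarefree_monomial mps_coeff_restrict)
  have "mps_coeff (f B * ?g) (squarefree_monomial (B \<union> ?C)) = subset_conv ?F ?G (B \<union> ?C)"
    using fin by (intro mps_coeff_mult_squarefree) simp
  also have "\<dots> = (\<Sum>T\<in>{B}. ?F T * ?G (B \<union> ?C - T))"
    unfolding subset_conv_def
  proof (rule sum.mono_neutral_right)
    show "\<forall>T\<in>Pow (B \<union> ?C) - {B}. ?F T * ?G (B \<union> ?C - T) = 0"
    proof
      fix T assume T: "T \<in> Pow (B \<union> ?C) - {B}"
      \<comment> \<open>A splitting other than \<open>B\<close> and \<open>?C\<close> gives one of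
        the factors a foreign variable.\<close>
      then have "\<not> T \<subseteq> B \<or> \<not> B \<union> ?C - T \<subseteq> ?C" using disj by blast
      then show "?F T * ?G (B \<union> ?C - T) = 0"
        using F0[of T] G0[of "B \<union> ?C - T"] T by auto
    qed
  qed (use fin in auto)
  also have "\<dots> = ?F B * ?G ?C"
    using disj by (simp add: Un_Diff Diff_triv inf_commute)
  finally have "mps_coeff (f B * ?g) (squarefree_monomial (B \<union> ?C)) = ?F B * ?G ?C" .
  moreover have "mps_restrict (B \<union> ?C) (f B * ?g) = f B * ?g"
    using mps_restrict_subset[of B "f B" "B \<union> ?C"] mps_restrict_subset[OF IH(2), of "B \<union> ?C"]
      insert.prems(3)[of B] by (simp add: mps_restrict_mult)
  ultimately show ?case using insert.hyps IH by simp
qed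

text \<open>The blocks of a partition are disjoint, so in each term the coefficient of g_1 ... g_n
  factors over the blocks.\<close>

lemma mps_coeff_cumulant:
  assumes "\<And>b. b \<subseteq> {1..n} \<Longrightarrow> mps_restrict b (f b) = f b"
  shows "mps_coeff (cumulant n f) (squarefree_monomial {1..n})
    = cumulant n (\<lambda>b. mps_coeff (f b) (squarefree_monomial b))"
  unfolding cumulant_def mps_coeff_sum
proof (rule sum.cong)
  fix P assume "P \<in> {P. partition_on {1..n} P}"
  then have P: "partition_on {1..n} P" by simp
  have sub: "b \<subseteq> {1..n}" if "b \<in> P" for b using that partition_onD1[OF P] by blast
  have "mps_coeff (\<Prod>b\<in>P. f b) (squarefree_monomial (\<Union>P))
      = (\<Prod>b\<in>P. mps_coeff (f b) (squarefree_monomial b))"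
    using mps_coeff_prod_disjoint[of P f] finite_elements[OF _ P] partition_onD2[OF P] assms
      sub finite_subset[OF sub] by simp
  moreover have "of_nat (fact (card P - 1)) * (- 1) ^ (card P - 1) * (\<Prod>b\<in>P. f b)
      = mps_const (of_nat (fact (card P - 1)) * (- 1) ^ (card P - 1)) * (\<Prod>b\<in>P. f b)"
    by (simp only: mps_const_mult mps_const_of_nat mps_const_neg_1_power)
  ultimately show "mps_coeff (of_nat (fact (card P - 1)) * (- 1) ^ (card P - 1) * (\<Prod>b\<in>P. f b))
      (squarefree_monomial {1..n}) = of_nat (fact (card P - 1)) * (- 1) ^ (card P - 1) *
        (\<Prod>b\<in>P. mps_coeff (f b) (squarefree_monomial b))"
    using partition_onD1[OF P] by (simp only: mps_coeff_const_mult)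
qed simp

text \<open>Putting g_k = 0 keeps the coefficient at \<open>e\<close> and, being a ring
  homomorphism, commutes with the cumulant, which then vanishes by independence.\<close>

lemma mps_coeff_cumulant_missing_variable:
  assumes "n \<ge> 2" "k \<in> {1..n}" "k \<notin> Poly_Mapping.keys e"
    and "\<And>b. b \<subseteq> {1..n} - {k} \<Longrightarrow> b \<noteq> {} \<Longrightarrow>
      mps_restrict (- {k}) (f (insert k b)) = mps_restrict (- {k}) (f b) * mps_restrict (- {k}) (f {k})"
  shows "mps_coeff (cumulant n f) e = 0"
proof -
  have "mps_restrict (- {k}) (cumulant n f) = cumulant n (\<lambda>b. mps_restrict (- {k}) (f b))"
    by (rule cumulant_hom) (rule mps_restrict_add mps_restrict_mult mps_restrict_1)+
  also have "\<dots> = 0"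
    using assms(1,2,4) by (rule cumulant_independent)
  finally have "mps_coeff (mps_restrict (- {k}) (cumulant n f)) e = 0"
    by (simp add: zero_mpseries.rep_eq)
  with assms(3) show ?thesis by (simp add: mps_coeff_restrict)
qed

subsection \<open>Cumulants of quotients\<close>

text \<open>The common shape of numerators and denominators: a pointer of \<open>b\<close> whose
  variable is absent from the monomial contributes only \<open>c k\<close>, and the remaining factor
  \<open>N e\<close> does not depend on \<open>b\<close>.\<close>

definition pointer_series :: "(nat \<Rightarrow> complex) \<Rightarrow> (monomial \<Rightarrow> complex) \<Rightarrow> nat set \<Rightarrow> mpseries" where
  "pointer_series c N b = Abs_mpseries (\<lambda>e. if Poly_Mapping.keys e \<subseteq> b
     then (\<Prod>k\<in>b - Poly_Mapping.keys e. c k) * N e else 0)"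

lemma mps_coeff_pointer_series:
  "mps_coeff (pointer_series c N b) e = (if Poly_Mapping.keys e \<subseteq> b
     then (\<Prod>k\<in>b - Poly_Mapping.keys e. c k) * N e else 0)"
  by (simp add: pointer_series_def)

lemma pointer_series_cong:
  assumes "\<And>k. k \<in> b \<Longrightarrow> c k = c' k"
  shows "pointer_series c N b = pointer_series c' N b"
proof -
  have "prod c (b - K) = prod c' (b - K)" for K
    using assms by (intro prod.cong) auto
  then show ?thesis unfolding pointer_series_def by presburger
qed

lemma restrict_pointer_series: "mps_restrict b (pointer_series c N b) = pointer_series c N b"
  by (rule mps_eqI) (simp add: mps_coeff_restrict mps_coeff_pointer_series)

text \<open>At g_k = 0 pointer \<open>k\<close> is never touched, so its factor \<open>c k\<close>
  comes out of every coefficient.\<close>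

lemma restrict_pointer_series_insert:
  assumes "finite b" "k \<notin> b"
  shows "mps_restrict (- {k}) (pointer_series c N (insert k b))
    = mps_const (c k) * pointer_series c N b"
proof (rule mps_eqI)
  fix e :: monomial
  have "(\<Prod>j\<in>insert k b - Poly_Mapping.keys e. c j) = c k * (\<Prod>j\<in>b - Poly_Mapping.keys e. c j)"
    if "k \<notin> Poly_Mapping.keys e"
    using assms that by (simp add: insert_Diff_if)
  then show "mps_coeff (mps_restrict (- {k}) (pointer_series c N (insert k b))) e
      = mps_coeff (mps_const (c k) * pointer_series c N b) e"
    using assms unfolding mps_coeff_restrict mps_coeff_const_mult mps_coeff_pointer_series
    by (auto simp: subset_insert)
qed

context
  fixes c :: "nat \<Rightarrow> complex" and N D :: "monomial \<Rightarrow> complex" and f :: "nat set \<Rightarrow> mpseries"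
  assumes f: "\<And>b. f b = mps_div (pointer_series c N b) (pointer_series (\<lambda>_. 1) D b)"
    and N0: "N 0 = D 0" and D0: "D 0 \<noteq> 0"
begin

lemma denominator_nonzero: "mps_coeff (pointer_series (\<lambda>_. 1) D b) 0 \<noteq> 0"
  by (simp add: mps_coeff_pointer_series D0)

lemma quotient_mult: "f b * pointer_series (\<lambda>_. 1) D b = pointer_series c N b"
  unfolding f by (rule mps_div_mult[OF denominator_nonzero])

lemma quotient_eqI: "q * pointer_series (\<lambda>_. 1) D b = pointer_series c N b \<Longrightarrow> q = f b"
  unfolding f by (rule mps_div_unique[OF denominator_nonzero])

text \<open>Restriction to \<open>b\<close> fixes numerator and denominator, so the restricted
  quotient solves the same equation.\<close>

lemma restrict_quotient: "mps_restrict b (f b) = f b"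
  by (rule quotient_eqI) (metis quotient_mult mps_restrict_mult restrict_pointer_series)

lemma quotient_coeff_0: "mps_coeff (f b) 0 = (\<Prod>k\<in>b. c k)"
proof -
  have "mps_coeff (f b) 0 * D 0 = (\<Prod>k\<in>b. c k) * D 0"
    using arg_cong[OF quotient_mult, of "\<lambda>q. mps_coeff q 0" b]
    by (simp add: mps_coeff_mult_0 mps_coeff_pointer_series N0)
  then show ?thesis using D0 by simp
qed

text \<open>For the empty set both series are constants, with equal values \<open>N 0\<close> and
  \<open>D 0\<close>.\<close>

lemma quotient_empty: "f {} = 1"
proof (rule sym, rule quotient_eqI, rule mps_eqI)
  fix e
  show "mps_coeff (1 * pointer_series (\<lambda>_. 1) D {}) e = mps_coeff (pointer_series c N {}) e"
    by (simp add: mps_coeff_pointer_series N0)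
qed

text \<open>At g_k = 0 pointer \<open>k\<close> contributes \<open>c k\<close> to the numerator and
  1 to the denominator.\<close>

lemma restrict_quotient_insert:
  assumes "finite b" "k \<notin> b"
  shows "mps_restrict (- {k}) (f (insert k b)) = mps_const (c k) * f b"
proof -
  let ?q = "mps_restrict (- {k}) (f (insert k b))"
  have "?q * mps_restrict (- {k}) (pointer_series (\<lambda>_. 1) D (insert k b))
      = mps_const (c k) * pointer_series c N b"
    unfolding mps_restrict_mult[symmetric] quotient_mult
    by (rule restrict_pointer_series_insert[OF assms])
  then have "?q * pointer_series (\<lambda>_. 1) D b
      = mps_const (c k) * f b * pointer_series (\<lambda>_. 1) D b"
    by (simp add: restrict_pointer_series_insert[OF assms] mps_const_1 mult.assoc quotient_mult)
  then show ?thesis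
    using mps_div_unique[OF denominator_nonzero] by metis
qed

lemma mps_coeff_cumulant_quotient_eq_0:
  assumes "n \<ge> 2" "k \<in> {1..n}" "k \<notin> Poly_Mapping.keys e"
  shows "mps_coeff (cumulant n f) e = 0"
proof (rule mps_coeff_cumulant_missing_variable[OF assms])
  fix b assume b: "b \<subseteq> {1..n} - {k}"
  then have "finite b" "k \<notin> b" using finite_subset by auto
  moreover have "mps_restrict (- {k}) (f b) = f b"
    using \<open>k \<notin> b\<close> by (intro mps_restrict_subset[OF restrict_quotient]) auto
  \<comment> \<open>The case \<open>b = {}\<close> of the same rule identifies the factor
    \<open>c k\<close> with the expectation for \<open>k\<close> alone.\<close>
  moreover have "mps_restrict (- {k}) (f {k}) = mps_const (c k)"
    using restrict_quotient_insert[of "{}" k] by (simp add: quotient_empty)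
  ultimately show "mps_restrict (- {k}) (f (insert k b))
      = mps_restrict (- {k}) (f b) * mps_restrict (- {k}) (f {k})"
    by (simp add: restrict_quotient_insert mult.commute)
qed

text \<open>All denominators are restrictions of one series \<open>D\<close>, so a single inverse
  serves every \<open>b\<close>. The factors \<open>c k\<close> of the numerator belong to the
  complement of its monomial, hence can be attached to the inverse.\<close>

lemma mps_coeff_quotient_squarefree:
  assumes "finite b"
  shows "mps_coeff (f b) (squarefree_monomial b) = subset_conv (\<lambda>S. N (squarefree_monomial S))
    (\<lambda>S. (\<Prod>k\<in>S. c k) * mps_coeff (mps_div 1 (Abs_mpseries D)) (squarefree_monomial S)) b"
proof -
  define E where "E = mps_div 1 (Abs_mpseries D)"
  have E: "E * Abs_mpseries D = 1"
    unfolding E_def using D0 by (intro mps_div_mult) simp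
  have den: "pointer_series (\<lambda>_. 1) D b = mps_restrict b (Abs_mpseries D)"
    by (rule mps_eqI) (simp add: mps_coeff_restrict mps_coeff_pointer_series)
  have "mps_restrict b E * pointer_series (\<lambda>_. 1) D b = 1"
    unfolding den mps_restrict_mult[symmetric] E by (rule mps_restrict_1)
  then have "f b = pointer_series c N b * mps_restrict b E"
    by (metis quotient_mult mult.assoc mult.commute mult.right_neutral)
  then have "mps_coeff (f b) (squarefree_monomial b) = subset_conv
      (\<lambda>T. mps_coeff (pointer_series c N b) (squarefree_monomial T))
      (\<lambda>T. mps_coeff (mps_restrict b E) (squarefree_monomial T)) b"
    using mps_coeff_mult_squarefree[OF assms] by simp
  also have "\<dots> = subset_conv (\<lambda>S. N (squarefree_monomial S))
      (\<lambda>S. (\<Prod>k\<in>S. c k) * mps_coeff E (squarefree_monomial S)) b"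
    unfolding subset_conv_def
    using keys_squarefree_monomial[OF finite_subset[OF _ assms]]
    by (intro sum.cong) (auto simp: mps_coeff_pointer_series mps_coeff_restrict)
  finally show ?thesis unfolding E_def .
qed

text \<open>Both numerator and denominator factor as \<open>cnj x\<close> times \<open>x\<close> in the algebra of set functions,
  so their logarithms are twice a real part.\<close>

lemma mps_coeff_cumulant_quotient:
  fixes a :: "nat set \<Rightarrow> complex" and \<sigma> \<rho> :: "nat \<Rightarrow> complex"
  assumes n: "n \<ge> 1" and a0: "a {} \<noteq> 0"
    and N: "\<And>S. S \<subseteq> {1..n} \<Longrightarrow> N (squarefree_monomial S)
      = subset_conv (\<lambda>T. cnj ((\<Prod>k\<in>T. \<rho> k) * a T)) (\<lambda>T. (\<Prod>k\<in>T. \<rho> k) * a T) S"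
    and D: "\<And>S. S \<subseteq> {1..n} \<Longrightarrow> D (squarefree_monomial S)
      = subset_conv (\<lambda>T. cnj ((\<Prod>k\<in>T. \<sigma> k) * a T)) (\<lambda>T. (\<Prod>k\<in>T. \<sigma> k) * a T) S"
    and c: "\<And>k. k \<in> {1..n} \<Longrightarrow> c k \<in> \<real>"
  shows "mps_coeff (cumulant n f) (squarefree_monomial {1..n})
    = of_real (2 * Re (((\<Prod>k=1..n. \<rho> k) - (\<Prod>k=1..n. c k * \<sigma> k)) * cumulant n (\<lambda>b. a b / a {})))"
proof -
  define w where "w S = a S / a {}" for S
  define x where "x S = (\<Prod>k\<in>S. \<rho> k) * w S" for S
  define y where "y S = (\<Prod>k\<in>S. c k * \<sigma> k) * w S" for S
  \<comment> \<open>The constant term shared by numerator and denominator; splitting it off gives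
    \<open>x\<close>, \<open>y\<close> and \<open>v'\<close> the value 1 at
    \<open>{}\<close>.\<close>
  define p where "p = cnj (a {}) * a {}"
  define E where "E S = mps_coeff (mps_div 1 (Abs_mpseries D)) (squarefree_monomial S)" for S
  define v where "v S = (\<Prod>k\<in>S. c k) * E S" for S
  define v' where "v' S = p * v S" for S
  have p: "p \<noteq> 0" using a0 by (simp add: p_def)
  have w1: "w {} = 1" using a0 by (simp add: w_def)
  have fin: "finite S" if "S \<subseteq> {1..n}" for S using that finite_subset by blast
  have Dp: "D 0 = p"
    using D[of "{}"] by (simp add: subset_conv_def p_def)
  have NN: "N (squarefree_monomial S) = p * subset_conv (\<lambda>T. cnj (x T)) x S" if "S \<subseteq> {1..n}" for S
    unfolding N[OF that] subset_conv_def sum_distrib_left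
    using a0 by (intro sum.cong) (auto simp: x_def w_def p_def)
  have cc: "cnj (\<Prod>k\<in>T. c k) = (\<Prod>k\<in>T. c k)" if "T \<subseteq> {1..n}" for T
    using that c by (auto simp: Reals_cnj_iff intro!: prod.cong)
  \<comment> \<open>As the \<open>c k\<close> are real, they can be absorbed both into
    \<open>y\<close> and into its conjugate.\<close>
  have DD: "(\<Prod>k\<in>S. c k) * D (squarefree_monomial S) = p * subset_conv (\<lambda>T. cnj (y T)) y S"
    if "S \<subseteq> {1..n}" for S
  proof -
    have "(\<Prod>k\<in>S. c k) * D (squarefree_monomial S)
        = subset_conv (\<lambda>T. (\<Prod>k\<in>T. c k) * cnj ((\<Prod>k\<in>T. \<sigma> k) * a T))
            (\<lambda>T. (\<Prod>k\<in>T. c k) * ((\<Prod>k\<in>T. \<sigma> k) * a T)) S"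
      unfolding D[OF that] by (rule subset_conv_scale[OF fin[OF that], symmetric])
    also have "\<dots> = p * subset_conv (\<lambda>T. cnj (y T)) y S"
      unfolding subset_conv_def sum_distrib_left
    proof (rule sum.cong)
      fix T assume "T \<in> Pow S"
      then have "cnj (\<Prod>k\<in>T. c k) = (\<Prod>k\<in>T. c k)" using that by (intro cc) auto
      then show "(\<Prod>k\<in>T. c k) * cnj ((\<Prod>k\<in>T. \<sigma> k) * a T) * ((\<Prod>k\<in>S - T. c k) * ((\<Prod>k\<in>S - T. \<sigma> k) * a (S - T)))
          = p * (cnj (y T) * y (S - T))"
        using a0 by (simp only: y_def w_def p_def prod.distrib complex_cnj_mult complex_cnj_divide) simp
    qed simp
    finally show ?thesis .
  qed
  have E0: "E {} * p = 1"
    using arg_cong[OF mps_div_mult[of "Abs_mpseries D" 1], of "\<lambda>q. mps_coeff q 0"] p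
    by (simp add: E_def mps_coeff_mult_0 Dp one_mpseries.rep_eq)
  have v1: "v' {} = 1" using E0 by (simp add: v'_def v_def mult.commute)
  have xy1: "x {} = 1" "y {} = 1" by (simp_all add: x_def y_def w1)
  \<comment> \<open>The identity E * D = 1, rescaled by the factors \<open>c k\<close>, says that
    \<open>v'\<close> inverts the product of \<open>y\<close> and its conjugate.\<close>
  have "subset_conv v' (subset_conv (\<lambda>T. cnj (y T)) y) S = set_unit S" if S: "S \<subseteq> {1..n}" for S
  proof -
    have "subset_conv v' (subset_conv (\<lambda>T. cnj (y T)) y) S
        = subset_conv (\<lambda>T. (\<Prod>k\<in>T. c k) * E T) (\<lambda>T. (\<Prod>k\<in>T. c k) * D (squarefree_monomial T)) S"
      unfolding subset_conv_def[of v'] subset_conv_def[of "\<lambda>T. (\<Prod>k\<in>T. c k) * E T"]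
    proof (rule sum.cong)
      fix T assume "T \<in> Pow S"
      then have "(\<Prod>k\<in>S - T. c k) * D (squarefree_monomial (S - T))
          = p * subset_conv (\<lambda>T. cnj (y T)) y (S - T)" using S by (intro DD) auto
      then show "v' T * subset_conv (\<lambda>T. cnj (y T)) y (S - T)
          = (\<Prod>k\<in>T. c k) * E T * ((\<Prod>k\<in>S - T. c k) * D (squarefree_monomial (S - T)))"
        by (simp add: v'_def v_def)
    qed simp
    also have "\<dots> = (\<Prod>k\<in>S. c k) * subset_conv E (\<lambda>T. D (squarefree_monomial T)) S"
      by (rule subset_conv_scale[OF fin[OF S]])
    also have "subset_conv E (\<lambda>T. D (squarefree_monomial T)) S = mps_coeff 1 (squarefree_monomial S)"
      using mps_coeff_mult_squarefree[OF fin[OF S], of "mps_div 1 (Abs_mpseries D)" "Abs_mpseries D"]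
        mps_div_mult[of "Abs_mpseries D" 1] D0 by (simp add: E_def[abs_def])
    also have "\<dots> = set_unit S"
      using keys_squarefree_monomial[OF fin[OF S]] by (auto simp: one_mpseries.rep_eq set_unit_def)
    finally show ?thesis by (auto simp: set_unit_def)
  qed
  then have "cumulant n (subset_conv v' (subset_conv (\<lambda>T. cnj (y T)) y)) = cumulant n set_unit"
    by (intro cumulant_cong) simp
  moreover have "cumulant n (subset_conv v' (subset_conv (\<lambda>T. cnj (y T)) y))
      = cumulant n v' + cumulant n (subset_conv (\<lambda>T. cnj (y T)) y)"
    by (rule cumulant_subset_conv[OF n]) (simp_all add: v1 xy1 subset_conv_def)
  moreover have "cumulant n (subset_conv (\<lambda>T. cnj (y T)) y) = cnj (cumulant n y) + cumulant n y"
    by (subst cumulant_subset_conv[OF n]) (simp_all add: xy1 cumulant_cnj)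
  \<comment> \<open>An inverse has the opposite logarithm.\<close>
  ultimately have v: "cumulant n v' = - (cnj (cumulant n y) + cumulant n y)"
    using cumulant_set_unit[OF n, where 'b = complex] by (metis eq_neg_iff_add_eq_0)
  have "mps_coeff (cumulant n f) (squarefree_monomial {1..n})
      = cumulant n (\<lambda>b. mps_coeff (f b) (squarefree_monomial b))"
    by (rule mps_coeff_cumulant) (rule restrict_quotient)
  also have "\<dots> = cumulant n (subset_conv (subset_conv (\<lambda>T. cnj (x T)) x) v')"
  proof (rule cumulant_cong)
    fix b assume b: "b \<subseteq> {1..n}"
    have "mps_coeff (f b) (squarefree_monomial b) = subset_conv (\<lambda>S. N (squarefree_monomial S)) v b"
      unfolding v_def E_def by (rule mps_coeff_quotient_squarefree[OF fin[OF b]])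
    \<comment> \<open>The factor \<open>p\<close> moves from \<open>N\<close> into
      \<open>v'\<close>.\<close>
    also have "\<dots> = subset_conv (subset_conv (\<lambda>T. cnj (x T)) x) v' b"
      unfolding subset_conv_def[of _ v] subset_conv_def[of _ v']
      using b by (intro sum.cong) (auto simp: NN v'_def)
    finally show "mps_coeff (f b) (squarefree_monomial b)
        = subset_conv (subset_conv (\<lambda>T. cnj (x T)) x) v' b" .
  qed
  also have "\<dots> = cumulant n (subset_conv (\<lambda>T. cnj (x T)) x) + cumulant n v'"
    by (rule cumulant_subset_conv[OF n]) (simp_all add: v1 xy1 subset_conv_def)
  also have "cumulant n (subset_conv (\<lambda>T. cnj (x T)) x) = cnj (cumulant n x) + cumulant n x"
    by (subst cumulant_subset_conv[OF n]) (simp_all add: xy1 cumulant_cnj)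
  also have "cnj (cumulant n x) + cumulant n x + cumulant n v'
      = of_real (2 * Re (cumulant n x - cumulant n y))"
    unfolding v by (simp add: complex_eq_iff)
  also have "cumulant n x - cumulant n y
      = ((\<Prod>k=1..n. \<rho> k) - (\<Prod>k=1..n. c k * \<sigma> k)) * cumulant n w"
    unfolding x_def[abs_def] y_def[abs_def] cumulant_scale by (simp only: left_diff_distrib)
  finally show ?thesis unfolding w_def .
qed

end

subsection \<open>Pointers\<close>

text \<open>Fubini for a finite product; each one-dimensional integrand is a product of two square
  integrable functions, hence integrable.\<close>

lemma joint_cinner_tensor:
  assumes "finite b"
  shows "joint_cinner b (\<lambda>x. \<alpha> * tensor b u x) (\<lambda>x. \<beta> * tensor b v x)
    = cnj \<alpha> * \<beta> * (\<Prod>k\<in>b. cinner (u k) (v k))"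
proof -
  interpret product_sigma_finite "\<lambda>_::nat. lborel :: real measure" ..
  have "joint_cinner b (\<lambda>x. \<alpha> * tensor b u x) (\<lambda>x. \<beta> * tensor b v x)
      = (\<integral>x. cnj \<alpha> * \<beta> * (\<Prod>k\<in>b. cnj (rep_L2 (u k) (x k)) * rep_L2 (v k) (x k)) \<partial>(Pi\<^sub>M b (\<lambda>_. lborel)))"
    unfolding joint_cinner_def tensor_def
    by (rule Bochner_Integration.integral_cong) (simp_all add: prod.distrib mult_ac)
  also have "\<dots> = cnj \<alpha> * \<beta> * (\<Prod>k\<in>b. cinner (u k) (v k))"
    using product_integral_prod[OF assms, of "\<lambda>k y. cnj (rep_L2 (u k) y) * rep_L2 (v k) y"]
      square_integrable_product square_integrable_rep
    by (simp add: cinner_L2_def)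
  finally show ?thesis .
qed

text \<open>What one pointer contributes when its exponential is expanded to order \<open>m\<close>
  in the bra and \<open>l\<close> in the ket.\<close>

definition interaction_moment :: "L2 operator \<Rightarrow> L2 operator \<Rightarrow> L2 \<Rightarrow> nat \<Rightarrow> nat \<Rightarrow> complex" where
  "interaction_moment s R \<phi> m l = cnj ((- \<i>) ^ m / fact m) * ((- \<i>) ^ l / fact l)
     * cinner (op_act (op_pow s m) \<phi>) (op_act (op_comp R (op_pow s l)) \<phi>)"

text \<open>The product runs only over pointers occurring in \<open>e\<close>, which makes the
  coefficient independent of \<open>b\<close>; the others are accounted for in
  \<open>pointer_series\<close>.\<close>

definition interaction_coeff ::
  "(monomial \<Rightarrow> complex) \<Rightarrow> (nat \<Rightarrow> L2) \<Rightarrow> (nat \<Rightarrow> L2 operator) \<Rightarrow> (nat \<Rightarrow> L2 operator)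
    \<Rightarrow> monomial \<Rightarrow> complex" where
  "interaction_coeff a \<phi> s R e = (\<Sum>(m, l)\<in>splittings e. cnj (a m) * a l * (\<Prod>k\<in>Poly_Mapping.keys e.
     interaction_moment (s k) (R k) (\<phi> k) (Poly_Mapping.lookup m k) (Poly_Mapping.lookup l k)))"

lemma interaction_moment_0: "interaction_moment s R \<phi> 0 0 = expval \<phi> R"
  by (simp add: interaction_moment_def expval_def op_comp_def op_id_def)

text \<open>The inner product factors over pointers, and a pointer absent from the monomial has
  order 0 on both sides, which leaves the initial expectation of \<open>R k\<close>.\<close>

lemma series_cinner_pointer_state:
  assumes "finite b"
  shows "series_cinner b (pointer_state n U \<psi>i \<psi>f A \<phi> s (\<lambda>_. op_id) b) (pointer_state n U \<psi>i \<psi>f A \<phi> s R b)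
    = pointer_series (\<lambda>k. expval (\<phi> k) (R k))
       (interaction_coeff (\<lambda>l. amplitude n U \<psi>i \<psi>f (\<lambda>k. op_pow (A k) (Poly_Mapping.lookup l k))) \<phi> s R) b"
proof (rule mps_eqI)
  fix e
  let ?a = "\<lambda>l. amplitude n U \<psi>i \<psi>f (\<lambda>k. op_pow (A k) (Poly_Mapping.lookup l k))"
  let ?M = "\<lambda>m l k. interaction_moment (s k) (R k) (\<phi> k) (Poly_Mapping.lookup m k) (Poly_Mapping.lookup l k)"
  let ?\<Psi> = "pointer_state n U \<psi>i \<psi>f A \<phi> s (\<lambda>_. op_id) b" and ?R\<Psi> = "pointer_state n U \<psi>i \<psi>f A \<phi> s R b"
  have "joint_cinner b (?\<Psi> m) (?R\<Psi> l) = (if Poly_Mapping.keys e \<subseteq> b then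
      (\<Prod>k\<in>b - Poly_Mapping.keys e. expval (\<phi> k) (R k))
        * (cnj (?a m) * ?a l * (\<Prod>k\<in>Poly_Mapping.keys e. ?M m l k)) else 0)"
    if ml: "m + l = e" for m l
  proof -
    have keys: "Poly_Mapping.keys e = Poly_Mapping.keys m \<union> Poly_Mapping.keys l"
      using keys_add_nat ml by blast
    show ?thesis
    proof (cases "Poly_Mapping.keys e \<subseteq> b")
      case True
      have "joint_cinner b (?\<Psi> m) (?R\<Psi> l)
          = cnj ((\<Prod>k\<in>b. (- \<i>) ^ Poly_Mapping.lookup m k / fact (Poly_Mapping.lookup m k)) * ?a m)
            * ((\<Prod>k\<in>b. (- \<i>) ^ Poly_Mapping.lookup l k / fact (Poly_Mapping.lookup l k)) * ?a l)
            * (\<Prod>k\<in>b. cinner (op_act (op_comp op_id (op_pow (s k) (Poly_Mapping.lookup m k))) (\<phi> k))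
                (op_act (op_comp (R k) (op_pow (s k) (Poly_Mapping.lookup l k))) (\<phi> k)))"
        using True keys unfolding pointer_state_def
        by (simp only: joint_cinner_tensor[OF assms] Un_subset_iff if_True)
      also have "\<dots> = cnj (?a m) * ?a l * (\<Prod>k\<in>b. ?M m l k)"
        unfolding interaction_moment_def prod.distrib
        by (simp add: op_comp_def op_id_def)
      also have "(\<Prod>k\<in>b. ?M m l k)
          = (\<Prod>k\<in>b - Poly_Mapping.keys e. ?M m l k) * (\<Prod>k\<in>Poly_Mapping.keys e. ?M m l k)"
        by (rule prod.subset_diff[OF True assms])
      also have "(\<Prod>k\<in>b - Poly_Mapping.keys e. ?M m l k) = (\<Prod>k\<in>b - Poly_Mapping.keys e. expval (\<phi> k) (R k))"
        by (rule prod.cong) (auto simp: keys in_keys_iff interaction_moment_0)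
      finally show ?thesis using True by simp
    next
      case False
      \<comment> \<open>A variable outside \<open>b\<close> occurs in \<open>m\<close> or in
        \<open>l\<close>, and the corresponding term of the state is zero.\<close>
      then have "?\<Psi> m = (\<lambda>x. 0) \<or> ?R\<Psi> l = (\<lambda>x. 0)"
        using keys by (auto simp: pointer_state_def)
      then show ?thesis using False by (auto simp: joint_cinner_def)
    qed
  qed
  then have "mps_coeff (series_cinner b ?\<Psi> ?R\<Psi>) e = (\<Sum>(m, l)\<in>splittings e. if Poly_Mapping.keys e \<subseteq> b then
      (\<Prod>k\<in>b - Poly_Mapping.keys e. expval (\<phi> k) (R k))
        * (cnj (?a m) * ?a l * (\<Prod>k\<in>Poly_Mapping.keys e. ?M m l k)) else 0)"
    unfolding series_cinner_def mps_coeff_Abs by (intro sum.cong) (auto simp: splittings_def)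
  then show "mps_coeff (series_cinner b ?\<Psi> ?R\<Psi>) e
      = mps_coeff (pointer_series (\<lambda>k. expval (\<phi> k) (R k)) (interaction_coeff ?a \<phi> s R) b) e"
    by (simp add: mps_coeff_pointer_series interaction_coeff_def sum_distrib_left case_prod_beta)
qed

text \<open>Each pointer of \<open>S\<close> acts once, either in the bra (\<open>T\<close>) or in
  the ket (\<open>S - T\<close>), so the coefficient is a conjugate set function convolved with the
  function itself.\<close>

lemma interaction_coeff_squarefree:
  assumes "finite S"
    and herm: "\<And>k. k \<in> S \<Longrightarrow>
      cinner (op_act (s k) (\<phi> k)) (op_act (R k) (\<phi> k)) = cnj (expval (\<phi> k) (op_comp (R k) (s k)))"
  shows "interaction_coeff a \<phi> s R (squarefree_monomial S) = subset_conv
    (\<lambda>T. cnj ((\<Prod>k\<in>T. - \<i> * expval (\<phi> k) (op_comp (R k) (s k))) * a (squarefree_monomial T)))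
    (\<lambda>T. (\<Prod>k\<in>T. - \<i> * expval (\<phi> k) (op_comp (R k) (s k))) * a (squarefree_monomial T)) S"
  unfolding interaction_coeff_def sum_splittings_squarefree[OF assms(1)] subset_conv_def
proof (rule sum.cong)
  fix T assume "T \<in> Pow S"
  then have T: "T \<subseteq> S" "finite T" using assms(1) finite_subset by auto
  let ?\<rho> = "\<lambda>k. - \<i> * expval (\<phi> k) (op_comp (R k) (s k))"
  let ?M = "\<lambda>k. interaction_moment (s k) (R k) (\<phi> k)
    (Poly_Mapping.lookup (squarefree_monomial T) k) (Poly_Mapping.lookup (squarefree_monomial (S - T)) k)"
  have "(\<Prod>k\<in>S. ?M k) = (\<Prod>k\<in>S - T. ?M k) * (\<Prod>k\<in>T. ?M k)"
    by (rule prod.subset_diff[OF T(1) assms(1)])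
  also have "(\<Prod>k\<in>S - T. ?M k) = (\<Prod>k\<in>S - T. ?\<rho> k)"
    using T assms(1) by (intro prod.cong)
      (auto simp: lookup_squarefree_monomial interaction_moment_def expval_def op_comp_def op_id_def)
  \<comment> \<open>The bra moment is the conjugate of the ket moment, by symmetry of
    \<open>R k\<close>.\<close>
  also have "(\<Prod>k\<in>T. ?M k) = (\<Prod>k\<in>T. cnj (?\<rho> k))"
  proof (rule prod.cong)
    fix k assume k: "k \<in> T"
    then have "cinner (op_act (s k) (\<phi> k)) (op_act (R k) (\<phi> k)) = cnj (expval (\<phi> k) (op_comp (R k) (s k)))"
      using T by (intro herm) auto
    then show "?M k = cnj (?\<rho> k)"
      using k T assms(1) by (simp add: lookup_squarefree_monomial interaction_moment_def op_comp_def op_id_def)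
  qed simp
  finally show "cnj (a (squarefree_monomial T)) * a (squarefree_monomial (S - T))
      * (\<Prod>k\<in>Poly_Mapping.keys (squarefree_monomial S). ?M k)
    = cnj ((\<Prod>k\<in>T. ?\<rho> k) * a (squarefree_monomial T)) * ((\<Prod>k\<in>S - T. ?\<rho> k) * a (squarefree_monomial (S - T)))"
    unfolding keys_squarefree_monomial[OF assms(1)] by simp
qed simp

section \<open>System amplitudes and weak values\<close>

lemma amplitude_cong:
  assumes "\<And>k. k \<in> {1..n} \<Longrightarrow> op_act (B k) = op_act (C k)"
  shows "amplitude n U \<psi>i \<psi>f B = amplitude n U \<psi>i \<psi>f C"
proof -
  have "evolve U B \<psi>i m = evolve U C \<psi>i m" if "m \<le> n" for m
    using that assms by (induction m) auto
  then show ?thesis by (simp add: amplitude_def)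
qed

text \<open>Exponents 1 and 0 select \<open>A k\<close> and the identity, and only the actions of
  the operators enter an amplitude.\<close>

lemma weak_value_eq_amplitude_quotient:
  assumes "finite b"
  shows "weak_value n U \<psi>i \<psi>f A b
    = amplitude n U \<psi>i \<psi>f (\<lambda>k. op_pow (A k) (Poly_Mapping.lookup (squarefree_monomial b) k))
      / amplitude n U \<psi>i \<psi>f (\<lambda>k. op_pow (A k) (Poly_Mapping.lookup 0 k))"
  unfolding weak_value_def using assms
  by (intro arg_cong2[where f = "(/)"] amplitude_cong)
    (auto simp: lookup_squarefree_monomial op_comp_def op_id_def)

theorem mainTheorem1:
  fixes n :: nat
    and A :: "nat \<Rightarrow> 'h::chilbert_space operator"
    and U :: "nat \<Rightarrow> 'h \<Rightarrow> 'h"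
    and \<psi>i \<psi>f :: 'h
    and \<phi> :: "nat \<Rightarrow> L2"
    and s r :: "nat \<Rightarrow> L2 operator"
    and \<xi> :: complex
  assumes "n \<ge> 1"
    and "\<And>k. k \<in> {1..n} \<Longrightarrow> hermitian (A k)"
    and "\<And>k. k \<in> {1..n + 1} \<Longrightarrow> unitary (U k)"
    and "amplitude n U \<psi>i \<psi>f (\<lambda>k. op_id) \<noteq> 0"
    and "\<And>k. k \<in> {1..n} \<Longrightarrow> norm (\<phi> k) = 1"
    and "\<And>k. k \<in> {1..n} \<Longrightarrow> hermitian (s k)"
    and "\<And>k. k \<in> {1..n} \<Longrightarrow> hermitian (r k)"
    and system_well_defined:
      "\<And>(l :: nat \<Rightarrow> nat) k. k \<in> {1..n} \<Longrightarrow>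
         U k (evolve U (\<lambda>j. op_pow (A j) (l j)) \<psi>i (k - 1)) \<in> op_dom (op_pow (A k) (l k))"
    and pointers_well_defined:
      "\<And>k l. k \<in> {1..n} \<Longrightarrow> \<phi> k \<in> op_dom (op_comp (r k) (op_pow (s k) l))"
    and \<xi>_def: "\<xi> = 2 * (- \<i>) ^ n *
       ((\<Prod>k=1..n. expval (\<phi> k) (op_comp (r k) (s k)))
        - (\<Prod>k=1..n. expval (\<phi> k) (r k) * expval (\<phi> k) (s k)))"
  shows "(n \<ge> 2 \<longrightarrow>
      eq_up_to_degree n
        (cumulant n (pointer_expectation n U \<psi>i \<psi>f A \<phi> s r))
        ((\<Prod>k=1..n. mps_var k) *
           mps_const (of_real (Re (\<xi> * cumulant n (weak_value n U \<psi>i \<psi>f A)))))) \<and>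
    (n = 1 \<longrightarrow>
      eq_up_to_degree 1
        (pointer_expectation n U \<psi>i \<psi>f A \<phi> s r {1})
        (mps_const (expval (\<phi> 1) (r 1)) +
           mps_var 1 * mps_const (of_real (Re (\<xi> * weak_value n U \<psi>i \<psi>f A {1})))))"
proof -
  define a where "a l = amplitude n U \<psi>i \<psi>f (\<lambda>k. op_pow (A k) (Poly_Mapping.lookup l k))" for l :: monomial
  define c where "c k = expval (\<phi> k) (r k)" for k
  define N where "N = interaction_coeff a \<phi> s r"
  define D where "D = interaction_coeff a \<phi> s (\<lambda>_. op_id)"
  define q where "q b = mps_div (pointer_series c N b) (pointer_series (\<lambda>_. 1) D b)" for b
  have unit: "expval (\<phi> k) op_id = 1" if "k \<in> {1..n}" for k
  proof -
    have "cinner (\<phi> k) (\<phi> k) \<in> \<real>"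
      using cinner_commute[of "\<phi> k" "\<phi> k"] by (simp add: Reals_cnj_iff)
    moreover have "Re (cinner (\<phi> k) (\<phi> k)) = 1"
      using assms(5)[OF that] by (simp add: Re_cinner dot_square_norm)
    ultimately show ?thesis
      by (simp add: expval_def op_id_def complex_eq_iff complex_is_Real_iff)
  qed
  \<comment> \<open>Orders 0 and 1 of the pointer assumption provide the vectors between which
    symmetry of \<open>r k\<close> is used.\<close>
  have dom: "\<phi> k \<in> op_dom (r k)" "op_act (s k) (\<phi> k) \<in> op_dom (r k)"
    if "k \<in> {1..n}" for k
    using pointers_well_defined[OF that, of 0] pointers_well_defined[OF that, of 1]
    by (simp_all add: op_comp_def op_id_def)
  have sym_r: "cinner (op_act (r k) x) y = cinner x (op_act (r k) y)"
    if "k \<in> {1..n}" "x \<in> op_dom (r k)" "y \<in> op_dom (r k)" for k x y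
    using assms(7)[OF that(1)] that by (simp add: hermitian_def)
  have herm_r: "cinner (op_act (s k) (\<phi> k)) (op_act (r k) (\<phi> k)) = cnj (expval (\<phi> k) (op_comp (r k) (s k)))"
    if "k \<in> {1..n}" for k
    using sym_r[OF that dom[OF that]] cinner_commute
    by (metis expval_def op_comp_def operator.sel(2))
  have herm_id: "cinner (op_act (s k) (\<phi> k)) (op_act op_id (\<phi> k))
      = cnj (expval (\<phi> k) (op_comp op_id (s k)))" if "k \<in> {1..n}" for k
    using cinner_commute[of "op_act (s k) (\<phi> k)" "\<phi> k"]
    by (simp add: expval_def op_comp_def op_id_def)
  have c_real: "c k \<in> \<real>" if "k \<in> {1..n}" for k
    using sym_r[OF that dom(1)[OF that] dom(1)[OF that]] cinner_commute[of "\<phi> k" "op_act (r k) (\<phi> k)"]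
    by (simp add: c_def Reals_cnj_iff expval_def)
  have a0: "a 0 \<noteq> 0"
    using assms(4) by (simp add: a_def)
  \<comment> \<open>Without any coupling, numerator and denominator both reduce to the squared
    modulus of \<open>a 0\<close>.\<close>
  have N0: "N 0 = D 0" and D0: "D 0 \<noteq> 0"
    using a0 by (simp_all add: N_def D_def interaction_coeff_def splittings_0)
  have series: "series_cinner b (pointer_state n U \<psi>i \<psi>f A \<phi> s (\<lambda>_. op_id) b) (pointer_state n U \<psi>i \<psi>f A \<phi> s r b)
        = pointer_series c N b"
      "series_cinner b (pointer_state n U \<psi>i \<psi>f A \<phi> s (\<lambda>_. op_id) b)
        (pointer_state n U \<psi>i \<psi>f A \<phi> s (\<lambda>_. op_id) b) = pointer_series (\<lambda>_. 1) D b"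
    if "b \<subseteq> {1..n}" for b
  proof -
    have "finite b" using that finite_subset by blast
    \<comment> \<open>Normalization of the pointer states turns the untouched factors of the
      denominator into 1.\<close>
    moreover have "pointer_series (\<lambda>k. expval (\<phi> k) op_id) D b = pointer_series (\<lambda>_. 1) D b"
      using that unit by (intro pointer_series_cong) auto
    ultimately show "series_cinner b (pointer_state n U \<psi>i \<psi>f A \<phi> s (\<lambda>_. op_id) b) (pointer_state n U \<psi>i \<psi>f A \<phi> s r b)
        = pointer_series c N b"
      "series_cinner b (pointer_state n U \<psi>i \<psi>f A \<phi> s (\<lambda>_. op_id) b)
        (pointer_state n U \<psi>i \<psi>f A \<phi> s (\<lambda>_. op_id) b) = pointer_series (\<lambda>_. 1) D b"
      by (simp_all add: series_cinner_pointer_state N_def D_def a_def[abs_def] c_def[abs_def])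
  qed
  have expectation: "pointer_expectation n U \<psi>i \<psi>f A \<phi> s r b = q b" if "b \<subseteq> {1..n}" for b
    using series[OF that] by (simp add: pointer_expectation_def q_def Let_def)
  \<comment> \<open>Here \<rho> is -i times the initial expectation of \<open>r k\<close> after
    \<open>s k\<close>; the denominator is the same construction with the identity for
    \<open>r k\<close>, so \<sigma> is -i times that of \<open>s k\<close>.\<close>
  have "mps_coeff (cumulant n q) (squarefree_monomial {1..n})
      = of_real (2 * Re (((\<Prod>k=1..n. - \<i> * expval (\<phi> k) (op_comp (r k) (s k)))
          - (\<Prod>k=1..n. c k * (- \<i> * expval (\<phi> k) (op_comp op_id (s k)))))
        * cumulant n (\<lambda>b. a (squarefree_monomial b) / a (squarefree_monomial {}))))"
  proof (rule mps_coeff_cumulant_quotient[OF q_def N0 D0 assms(1)])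
    fix S assume S: "S \<subseteq> {1..n}"
    then have "finite S" using finite_subset by blast
    then show "N (squarefree_monomial S) = subset_conv
        (\<lambda>T. cnj ((\<Prod>k\<in>T. - \<i> * expval (\<phi> k) (op_comp (r k) (s k))) * a (squarefree_monomial T)))
        (\<lambda>T. (\<Prod>k\<in>T. - \<i> * expval (\<phi> k) (op_comp (r k) (s k))) * a (squarefree_monomial T)) S"
      "D (squarefree_monomial S) = subset_conv
        (\<lambda>T. cnj ((\<Prod>k\<in>T. - \<i> * expval (\<phi> k) (op_comp op_id (s k))) * a (squarefree_monomial T)))
        (\<lambda>T. (\<Prod>k\<in>T. - \<i> * expval (\<phi> k) (op_comp op_id (s k))) * a (squarefree_monomial T)) S"
      unfolding N_def D_def using S herm_r herm_id by (intro interaction_coeff_squarefree; blast)+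
  qed (use a0 c_real in auto)
  also have "cumulant n (\<lambda>b. a (squarefree_monomial b) / a (squarefree_monomial {}))
      = cumulant n (weak_value n U \<psi>i \<psi>f A)"
  proof (rule cumulant_cong)
    fix b assume "b \<subseteq> {1..n}"
    then have "finite b" using finite_subset by blast
    then show "a (squarefree_monomial b) / a (squarefree_monomial {}) = weak_value n U \<psi>i \<psi>f A b"
      by (simp add: weak_value_eq_amplitude_quotient a_def)
  qed
  also have "(\<Prod>k=1..n. - \<i> * expval (\<phi> k) (op_comp (r k) (s k)))
      = (- \<i>) ^ n * (\<Prod>k=1..n. expval (\<phi> k) (op_comp (r k) (s k)))"
    by (simp only: prod.distrib prod_constant) simp
  also have "(\<Prod>k=1..n. c k * (- \<i> * expval (\<phi> k) (op_comp op_id (s k))))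
      = (- \<i>) ^ n * (\<Prod>k=1..n. expval (\<phi> k) (r k) * expval (\<phi> k) (s k))"
  proof -
    have "(\<Prod>k=1..n. c k * (- \<i> * expval (\<phi> k) (op_comp op_id (s k))))
        = (\<Prod>k=1..n. - \<i> * (expval (\<phi> k) (r k) * expval (\<phi> k) (s k)))"
      by (rule prod.cong) (simp_all add: c_def expval_def op_comp_def op_id_def)
    then show ?thesis by (simp only: prod.distrib prod_constant) simp
  qed
  also have "2 * Re (((- \<i>) ^ n * (\<Prod>k=1..n. expval (\<phi> k) (op_comp (r k) (s k)))
        - (- \<i>) ^ n * (\<Prod>k=1..n. expval (\<phi> k) (r k) * expval (\<phi> k) (s k)))
        * cumulant n (weak_value n U \<psi>i \<psi>f A))
      = Re (\<xi> * cumulant n (weak_value n U \<psi>i \<psi>f A))"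
    unfolding \<xi>_def right_diff_distrib[symmetric] mult.assoc by simp
  finally have top: "mps_coeff (cumulant n q) (squarefree_monomial {1..n})
      = of_real (Re (\<xi> * cumulant n (weak_value n U \<psi>i \<psi>f A)))" .
  have rhs: "mps_coeff ((\<Prod>k=1..n. mps_var k) * mps_const z) e = of_bool (e = squarefree_monomial {1..n}) * z"
    for e z by (simp add: mult.commute[of _ "mps_const z"] mps_coeff_const_mult mps_coeff_prod_var)
  show ?thesis
  proof (intro conjI impI)
    assume n2: "n \<ge> 2"
    have "cumulant n (pointer_expectation n U \<psi>i \<psi>f A \<phi> s r) = cumulant n q"
      by (rule cumulant_cong) (rule expectation)
    moreover have "mps_coeff (cumulant n q) e = 0"
      if "total_degree e \<le> n" "e \<noteq> squarefree_monomial {1..n}" for e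
    proof -
      \<comment> \<open>A monomial of degree at most n containing all n variables would be g_1 ...
        g_n.\<close>
      have "\<not> {1..n} \<subseteq> Poly_Mapping.keys e"
        using that total_degree_le_imp_squarefree[of "{1..n}" e] by auto
      then obtain k where "k \<in> {1..n}" "k \<notin> Poly_Mapping.keys e" by blast
      then show ?thesis
        by (rule mps_coeff_cumulant_quotient_eq_0[OF q_def N0 D0 n2])
    qed
    ultimately show "eq_up_to_degree n (cumulant n (pointer_expectation n U \<psi>i \<psi>f A \<phi> s r))
        ((\<Prod>k=1..n. mps_var k) * mps_const (of_real (Re (\<xi> * cumulant n (weak_value n U \<psi>i \<psi>f A)))))"
      unfolding eq_up_to_degree_def rhs using top by auto
  next
    assume n1: "n = 1"
    have "mps_coeff (q {1}) e = mps_coeff (mps_const (expval (\<phi> 1) (r 1)) +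
        mps_var 1 * mps_const (of_real (Re (\<xi> * weak_value n U \<psi>i \<psi>f A {1})))) e"
      if "total_degree e \<le> 1" for e
    proof (cases "1 \<in> Poly_Mapping.keys e")
      case True
      then have "e = squarefree_monomial {1}"
        using that by (intro total_degree_le_imp_squarefree) auto
      moreover from this True have "e \<noteq> 0" by auto
      ultimately show ?thesis
        using top rhs[of _ e] by (simp add: n1 cumulant_1[unfolded One_nat_def] plus_mpseries.rep_eq mps_const.rep_eq)
    next
      case False
      \<comment> \<open>A nonconstant monomial without g_1 contains a variable on which
        \<open>q {1}\<close> does not depend.\<close>
      have "mps_coeff (q {1}) e = (if e = 0 then c 1 else 0)"
      proof (cases "e = 0")
        case True
        then show ?thesis using quotient_coeff_0[OF q_def N0 D0, of "{1}"] by simp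
      next
        case nz: False
        then have "\<not> Poly_Mapping.keys e \<subseteq> {1}" using False by (auto simp: subset_singleton_iff)
        then show ?thesis
          using nz restrict_quotient[OF q_def N0 D0, of "{1}"] mps_coeff_restrict[of "{1}" "q {1}" e] by simp
      qed
      moreover have "e \<noteq> squarefree_monomial {1}" using False keys_squarefree_monomial[of "{1}"] by auto
      ultimately show ?thesis
        using rhs[of _ e] by (simp add: n1 c_def plus_mpseries.rep_eq mps_const.rep_eq)
    qed
    moreover have "pointer_expectation n U \<psi>i \<psi>f A \<phi> s r {1} = q {1}"
      using expectation[of "{1}"] n1 by simp
    ultimately show "eq_up_to_degree 1 (pointer_expectation n U \<psi>i \<psi>f A \<phi> s r {1})
        (mps_const (expval (\<phi> 1) (r 1)) +
          mps_var 1 * mps_const (of_real (Re (\<xi> * weak_value n U \<psi>i \<psi>f A {1}))))"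
      unfolding eq_up_to_degree_def by simp
  qed
qed

end
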